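(* Let $B=B[0]$ be an $n\times n$ skew-symmetrizable integer matrix with skew-symmetrizer $D=\mathrm{diag}(d_1,\dots,d_n)$, let $k_0,\dots,k_{T-1}\in\{1,\dots,n\}$, let $\varepsilon_0,\dots,\varepsilon_{T-1}$ be the associated tropical sign sequence, and let $\sigma$ be a permutation of $\{1,\dots,n\}$. Suppose that the sequence of signed mutations $$(u[0],p[0])\overset{\mu^{B[0]}_{k_0,\varepsilon_0}}{\mapsto}(u[1],p[1])\overset{\mu^{B[1]}_{k_1,\varepsilon_1}}{\mapsto}\cdots\overset{\mu^{B[T-1]}_{k_{T-1},\varepsilon_{T-1}}}{\mapsto}(u[T],p[T])$$ on $\mathbb{R}^{2n}$ is $\sigma$-periodic. Then, for any Hamiltonian flow (i.e. for any initial point $(u[0],p[0])$), the action integral satisfies $$S=0.$$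
   Context: Signs $\pm$ are identified with $\pm1$; $[a]_+=\max(a,0)$. $D$ (positive integers $d_i$) is a skew-symmetrizer of $B$ if $d_ib_{ij}=-d_jb_{ji}$. Matrix mutation $B\mapsto B'=\mu_k(B)$: $b'_{ij}=-b_{ij}$ if $i=k$ or $j=k$, else $b'_{ij}=b_{ij}+[-\varepsilon b_{ik}]_+b_{kj}+b_{ik}[\varepsilon b_{kj}]_+$ (independent of $\varepsilon$). $B[s+1]=\mu_{k_s}(B[s])$; $D$ is a common skew-symmetrizer of all $B[s]$. Tropical sign sequence: Let $\mathbb{Q}_+(y)$ be the semifield of subtraction-free rational functions in formal variables $y=(y_1,\dots,y_n)$ (quotients of nonzero polynomials with nonnegative integer coefficients). Put $y[0]=y$ and let $y[s+1]$ be obtained from $y[s]$ by $y'_{k}=y_{k}^{-1}$, $y'_i=y_iy_k^{[\varepsilon b_{ki}]_+}(1+y_k^{\varepsilon})^{-b_{ki}}$ ($i\ne k$) with $k=k_s$, $B=B[s]$. Let $\pi_{\mathrm{trop}}$ be the semifield homomorphism, $y_i\mapsto y_i$, from $\mathbb{Q}_+(y)$ to the semifield $\mathrm{Trop}(y)$ of Laurent monomials in $y$ with addition $\prod y_i^{a_i}\oplus\prod y_i^{b_i}=\prod y_i^{\min(a_i,b_i)}$. It is known that the exponent vector of $\pi_{\mathrm{trop}}(y_i[s])$ is nonzero with entries all nonnegative or all nonpositive; $\varepsilon_s=+$ or $-$ accordingly for $i=k_s$. Signed mutations: for $(u,p)\in\mathbb{R}^{2n}$ and a matrix $B$ put $w_i=\sum_jb_{ji}u_j$,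 $y_i=e^{d_ip_i+w_i}$, and $H^B_{k,\varepsilon}=\frac{\varepsilon}{2d_k}\mathrm{Li}_2(-y_k^{\varepsilon})$, with $\mathrm{Li}_2(-x)=-\int_0^x\frac{\log(1+z)}{z}dz$. $\rho^B_{k,\varepsilon}$ is the time one flow of $\dot u_i=\partial H/\partial p_i$, $\dot p_i=-\partial H/\partial u_i$ with $H=H^B_{k,\varepsilon}$; $\tau^B_{k,\varepsilon}:(u,p)\mapsto(u',p')$ is $u'_k=-u_k+\sum_j[-\varepsilon b_{jk}]_+u_j$, $u'_i=u_i$ ($i\neq k$), $p'_k=-p_k$, $p'_i=p_i+[-\varepsilon b_{ik}]_+p_k$ ($i\ne k$); $\mu^B_{k,\varepsilon}=\tau^B_{k,\varepsilon}\circ\rho^B_{k,\varepsilon}$. The sequence of signed mutations is $\sigma$-periodic if for every initial point $(u[0],p[0])\in\mathbb{R}^{2n}$ and all $i,j$: $b_{\sigma^{-1}(i)\sigma^{-1}(j)}[T]=b_{ij}[0]$, $u_{\sigma^{-1}(i)}[T]=u_i[0]$, $p_{\sigma^{-1}(i)}[T]=p_i[0]$. Hamiltonian flow from time $0$ to $T$: given an arbitrary initial point $(u[0],p[0])$, during $[s,s+1]$ the flow, in the $s$-th canonical coordinates, starts at $(u[s],p[s])$ at time $s$ and follows Hamilton's equations for $H[s]=H^{B[s]}_{k_s,\varepsilon_s}=\frac{\varepsilon_s}{2d_{k_s}}\mathrm{Li}_2(-y_{k_s}[s]^{\varepsilon_s})$; at time $s+1$ one passes to the $(s+1)$-st coordinates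 by $\tau^{B[s]}_{k_s,\varepsilon_s}$, reaching $(u[s+1],p[s+1])$. The Lagrangian for $[s,s+1]$ is $\mathscr{L}[s]=\dot u_{k_s}[s]\,p_{k_s}[s]-H[s]$ (with $\dot u_{k_s}[s]=-\frac12\log(1+y_{k_s}[s]^{\varepsilon_s})$). The action integral is $S=\sum_{s=0}^{T-1}S[s]$, $S[s]=\int_s^{s+1}\mathscr{L}[s]\,dt$, evaluated along the flow in the $s$-th coordinates. *)

theory Defs
  imports
    "HOL-Analysis.Analysis"
    "HOL-Library.Poly_Mapping"
    "HOL-Computational_Algebra.Fraction_Field"
    "HOL-Combinatorics.Permutations"
begin

section \<open>Matrix mutation\<close>

type_synonym 'n int_vec = "int ^ 'n"
type_synonym 'n int_mat = "int ^ 'n ^ 'n"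

definition pos_part :: "int \<Rightarrow> int" where
  "pos_part a = max a 0"

definition skew_symmetrizer :: "'n::finite int_vec \<Rightarrow> 'n int_mat \<Rightarrow> bool" where
  "skew_symmetrizer d B \<longleftrightarrow>
     (\<forall>i. 0 < d $ i) \<and> (\<forall>i j. d $ i * B $ i $ j = - (d $ j * B $ j $ i))"

definition matrix_mutation ::
    "int \<Rightarrow> 'n::finite \<Rightarrow> 'n int_mat \<Rightarrow> 'n int_mat" where
  "matrix_mutation \<epsilon> k B = (\<chi> i j.
     if i = k \<or> j = k then - B $ i $ j
     else B $ i $ j + pos_part (- \<epsilon> * B $ i $ k) * B $ k $ j
            + B $ i $ k * pos_part (\<epsilon> * B $ k $ j))"

lemma matrix_mutation_sign_independent:
  "matrix_mutation (- 1) k B = matrix_mutation 1 k B"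
proof -
  have *: "max a 0 * b + a * max (- b) 0 = max (- a) 0 * b + a * max b (0::int)" for a b
    by (cases "0 \<le> a"; cases "0 \<le> b") (auto simp: max_def algebra_simps)
  show ?thesis
    unfolding matrix_mutation_def pos_part_def
    by (simp add: vec_eq_iff add.assoc *)
qed

text \<open>Since matrix mutation does not depend on the sign, the sequence uses the sign \<open>1\<close>.\<close>

primrec B_seq :: "'n::finite int_mat \<Rightarrow> (nat \<Rightarrow> 'n) \<Rightarrow> nat \<Rightarrow> 'n int_mat" where
  "B_seq B k 0 = B"
| "B_seq B k (Suc s) = matrix_mutation 1 (k s) (B_seq B k s)"


section \<open>Subtraction-free rational functions and tropical signs\<close>

text \<open>
  A polynomial is a finitely supported map from exponents to coefficients.  The linear order
  on the index type is needed only because the library derives that these polynomials form an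
  integral domain from a monomial order.
\<close>

type_synonym 'n int_mpoly = "('n \<Rightarrow>\<^sub>0 nat) \<Rightarrow>\<^sub>0 int"
type_synonym 'n rat_fun = "'n int_mpoly fract"

definition nonneg_mpoly :: "'n int_mpoly \<Rightarrow> bool" where
  "nonneg_mpoly f \<longleftrightarrow> f \<noteq> 0 \<and> (\<forall>m. 0 \<le> Poly_Mapping.lookup f m)"

definition subfree :: "'n::linorder rat_fun set" where
  "subfree = {Fract f g | f g. nonneg_mpoly f \<and> nonneg_mpoly g}"

definition y_var :: "'n \<Rightarrow> 'n::linorder rat_fun" where
  "y_var i = Fract (Poly_Mapping.single (Poly_Mapping.single i 1) 1) 1"

definition y_mutation ::
    "int \<Rightarrow> 'n int_mat \<Rightarrow> 'n \<Rightarrow> ('n \<Rightarrow> 'n rat_fun) \<Rightarrow> 'n \<Rightarrow> 'n::{finite,linorder} rat_fun" where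
  "y_mutation \<epsilon> B k y i =
     (if i = k then inverse (y k)
      else y i * y k powi pos_part (\<epsilon> * B $ k $ i) * (1 + y k powi \<epsilon>) powi (- B $ k $ i))"

lemma y_mutation_sign_independent:
  assumes "y k \<noteq> 0"
  shows "y_mutation (- 1) B k y = y_mutation 1 B k y"
proof
  fix i
  have 1: "1 + inverse (y k) = (1 + y k) * inverse (y k)"
    using assms by (simp add: field_simps)
  define b where "b = B $ k $ i"
  have 2: "y k powi max (- b) 0 * inverse (y k) powi (- b) = y k powi max b 0"
    using assms
    by (cases "0 \<le> b") (auto simp: max_def power_int_minus power_int_inverse)
  have "y k powi max (- b) 0 * (1 + y k powi (- 1)) powi (- b)
      = (y k powi max (- b) 0 * inverse (y k) powi (- b)) * (1 + y k) powi (- b)"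
    by (simp add: 1 power_int_mult_distrib mult_ac)
  also have "\<dots> = y k powi max b 0 * (1 + y k) powi (- b)"
    unfolding 2 ..
  finally show "y_mutation (- 1) B k y i = y_mutation 1 B k y i"
    by (simp add: y_mutation_def pos_part_def mult.assoc b_def)
qed

primrec y_seq ::
    "'n int_mat \<Rightarrow> (nat \<Rightarrow> 'n) \<Rightarrow> nat \<Rightarrow> 'n \<Rightarrow> 'n::{finite,linorder} rat_fun" where
  "y_seq B k 0 = y_var"
| "y_seq B k (Suc s) = y_mutation 1 (B_seq B k s) (k s) (y_seq B k s)"

text \<open>
  Elements of the tropical semifield are given by their exponent vectors, so that its
  multiplication is addition and its addition is the componentwise minimum.
\<close>

definition trop_hom :: "('n::{finite,linorder} rat_fun \<Rightarrow> 'n int_vec) \<Rightarrow> bool" where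
  "trop_hom \<phi> \<longleftrightarrow> (\<forall>f\<in>subfree. \<forall>g\<in>subfree.
     \<phi> (f * g) = \<phi> f + \<phi> g \<and> \<phi> (f + g) = (\<chi> i. min (\<phi> f $ i) (\<phi> g $ i)))"

lemma lookup_mult_nonneg:
  fixes f g :: "'n::linorder int_mpoly"
  assumes "\<And>m. 0 \<le> Poly_Mapping.lookup f m" "\<And>m. 0 \<le> Poly_Mapping.lookup g m"
  shows "0 \<le> Poly_Mapping.lookup (f * g) m"
  unfolding lookup_mult Sum_any.expand_set
  by (intro sum_nonneg mult_nonneg_nonneg assms) (auto simp: when_def assms)

lemma keys_add_nonneg:
  assumes "nonneg_mpoly f" "nonneg_mpoly g"
  shows "Poly_Mapping.keys (f + g) = Poly_Mapping.keys f \<union> Poly_Mapping.keys g"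
  using assms
  by (auto simp: nonneg_mpoly_def in_keys_iff lookup_add add_nonneg_eq_0_iff)

lemma keys_mult_nonneg:
  fixes f g :: "'n::linorder int_mpoly"
  assumes "nonneg_mpoly f" "nonneg_mpoly g"
  shows "Poly_Mapping.keys (f * g) = {a + b | a b. a \<in> Poly_Mapping.keys f \<and> b \<in> Poly_Mapping.keys g}"
proof (intro equalityI keys_mult subsetI)
  fix m assume "m \<in> {a + b | a b. a \<in> Poly_Mapping.keys f \<and> b \<in> Poly_Mapping.keys g}"
  then obtain a b where m: "m = a + b" and ab: "a \<in> Poly_Mapping.keys f" "b \<in> Poly_Mapping.keys g"
    by auto
  define c where "c = Poly_Mapping.lookup f a"
  define e where "e = Poly_Mapping.lookup g b"
  have pos: "c > 0" "e > 0"
    using assms ab unfolding nonneg_mpoly_def c_def e_def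
    by (metis in_keys_iff order_le_less)+
  define f' where "f' = f - Poly_Mapping.single a c"
  define g' where "g' = g - Poly_Mapping.single b e"
  have nn: "0 \<le> Poly_Mapping.lookup f' l" "0 \<le> Poly_Mapping.lookup g' l"
       "0 \<le> Poly_Mapping.lookup f l" "0 \<le> Poly_Mapping.lookup (Poly_Mapping.single a c) l" for l
    using assms pos by (auto simp: f'_def g'_def lookup_minus lookup_single when_def c_def e_def nonneg_mpoly_def)
  have "f * g = Poly_Mapping.single a c * Poly_Mapping.single b e
      + (Poly_Mapping.single a c * g' + f' * g)"
    by (simp add: f'_def g'_def algebra_simps)
  moreover have "0 \<le> Poly_Mapping.lookup (Poly_Mapping.single a c * g') m"
    by (intro lookup_mult_nonneg nn)
  moreover have "0 \<le> Poly_Mapping.lookup (f' * g) m"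
    using assms by (intro lookup_mult_nonneg nn) (auto simp: nonneg_mpoly_def)
  ultimately have "Poly_Mapping.lookup (f * g) m \<ge> c * e"
    by (simp add: lookup_add mult_single m)
  with pos show "m \<in> Poly_Mapping.keys (f * g)"
    by (metis in_keys_iff mult_pos_pos not_le)
qed

lemma nonneg_mpoly_add: "nonneg_mpoly f \<Longrightarrow> nonneg_mpoly g \<Longrightarrow> nonneg_mpoly (f + g)"
  using keys_add_nonneg[of f g]
  by (auto simp: nonneg_mpoly_def lookup_add simp flip: keys_eq_empty)

lemma nonneg_mpoly_mult:
  fixes f g :: "'n::linorder int_mpoly"
  shows "nonneg_mpoly f \<Longrightarrow> nonneg_mpoly g \<Longrightarrow> nonneg_mpoly (f * g)"
  by (auto simp: nonneg_mpoly_def intro: lookup_mult_nonneg)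

lemma nonneg_mpoly_single: "c > 0 \<Longrightarrow> nonneg_mpoly (Poly_Mapping.single m c)"
  by (auto simp: nonneg_mpoly_def lookup_single when_def single_zero simp flip: keys_eq_empty)

lemma nonneg_mpoly_1: "nonneg_mpoly 1"
  unfolding single_one[symmetric] by (rule nonneg_mpoly_single) simp

text \<open>
  On \<open>Fract f g\<close> the tropical evaluation is \<open>min_exp f - min_exp g\<close>; this yields the existence
  and uniqueness of the homomorphism that defines \<open>pi_trop\<close> below.
\<close>

definition min_exp :: "'n::{finite,linorder} int_mpoly \<Rightarrow> 'n int_vec" where
  "min_exp f = (\<chi> i. int (Min ((\<lambda>m. Poly_Mapping.lookup m i) ` Poly_Mapping.keys f)))"

lemma min_exp_add:
  assumes "nonneg_mpoly f" "nonneg_mpoly g"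
  shows "min_exp (f + g) = (\<chi> i. min (min_exp f $ i) (min_exp g $ i))"
proof -
  have "Poly_Mapping.keys f \<noteq> {}" "Poly_Mapping.keys g \<noteq> {}"
    using assms by (auto simp: nonneg_mpoly_def)
  then show ?thesis
    using assms by (simp add: min_exp_def keys_add_nonneg image_Un Min_Un vec_eq_iff of_nat_min)
qed

lemma min_exp_mult:
  assumes "nonneg_mpoly f" "nonneg_mpoly g"
  shows "min_exp (f * g) = min_exp f + min_exp g"
proof -
  have ne: "Poly_Mapping.keys f \<noteq> {}" "Poly_Mapping.keys g \<noteq> {}"
    using assms by (auto simp: nonneg_mpoly_def)
  have "Min ((\<lambda>m. Poly_Mapping.lookup m i) ` Poly_Mapping.keys (f * g))
      = Min ((\<lambda>m. Poly_Mapping.lookup m i) ` Poly_Mapping.keys f)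
      + Min ((\<lambda>m. Poly_Mapping.lookup m i) ` Poly_Mapping.keys g)" for i
  proof (rule Min_eqI)
    show "finite ((\<lambda>m. Poly_Mapping.lookup m i) ` Poly_Mapping.keys (f * g))" by simp
  next
    fix y assume "y \<in> (\<lambda>m. Poly_Mapping.lookup m i) ` Poly_Mapping.keys (f * g)"
    then show "Min ((\<lambda>m. Poly_Mapping.lookup m i) ` Poly_Mapping.keys f)
      + Min ((\<lambda>m. Poly_Mapping.lookup m i) ` Poly_Mapping.keys g) \<le> y"
      using assms by (auto simp: keys_mult_nonneg lookup_add intro!: add_mono Min_le)
  next
    have "Min ((\<lambda>m. Poly_Mapping.lookup m i) ` Poly_Mapping.keys f) \<in> (\<lambda>m. Poly_Mapping.lookup m i) ` Poly_Mapping.keys f"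
      using ne by (intro Min_in) auto
    moreover have "Min ((\<lambda>m. Poly_Mapping.lookup m i) ` Poly_Mapping.keys g) \<in> (\<lambda>m. Poly_Mapping.lookup m i) ` Poly_Mapping.keys g"
      using ne by (intro Min_in) auto
    ultimately obtain a b where
      "a \<in> Poly_Mapping.keys f" "Min ((\<lambda>m. Poly_Mapping.lookup m i) ` Poly_Mapping.keys f) = Poly_Mapping.lookup a i"
      "b \<in> Poly_Mapping.keys g" "Min ((\<lambda>m. Poly_Mapping.lookup m i) ` Poly_Mapping.keys g) = Poly_Mapping.lookup b i"
      by auto
    then show "Min ((\<lambda>m. Poly_Mapping.lookup m i) ` Poly_Mapping.keys f)
      + Min ((\<lambda>m. Poly_Mapping.lookup m i) ` Poly_Mapping.keys g)
       \<in> (\<lambda>m. Poly_Mapping.lookup m i) ` Poly_Mapping.keys (f * g)"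
      using assms by (auto simp: keys_mult_nonneg lookup_add intro!: image_eqI[of _ _ "a + b"])
  qed
  then show ?thesis
    by (simp add: min_exp_def vec_eq_iff)
qed

lemma trop_hom_unique_on_polys:
  fixes f :: "'n::{finite,linorder} int_mpoly"
  assumes \<phi>: "trop_hom \<phi>" "\<And>i. \<phi> (y_var i) = axis i 1"
    and \<psi>: "trop_hom \<psi>" "\<And>i. \<psi> (y_var i) = axis i 1"
  shows "nonneg_mpoly f \<Longrightarrow> \<phi> (Fract f 1) = \<psi> (Fract f 1)"
proof -
  have sf: "Fract g 1 \<in> subfree" if "nonneg_mpoly g" for g :: "'n int_mpoly"
    using that nonneg_mpoly_1 unfolding subfree_def by blast
  have mono: "\<phi> (Fract (Poly_Mapping.single m 1) 1) = \<psi> (Fract (Poly_Mapping.single m 1) 1)"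
    for m :: "'n \<Rightarrow>\<^sub>0 nat"
  proof (induction "\<Sum>i\<in>UNIV. Poly_Mapping.lookup m i" arbitrary: m rule: less_induct)
    case less
    show ?case
    proof (cases "m = 0")
      case True
      have one: "\<theta> 1 = 0" if "trop_hom \<theta>" for \<theta> :: "'n rat_fun \<Rightarrow> 'n int_vec"
      proof -
        have "1 \<in> (subfree :: 'n rat_fun set)"
          using sf[OF nonneg_mpoly_1] by (simp add: One_fract_def)
        then have "\<theta> (1 * 1) = \<theta> 1 + \<theta> 1"
          using that unfolding trop_hom_def by blast
        then show ?thesis by simp
      qed
      then show ?thesis
        using True one[OF \<phi>(1)] one[OF \<psi>(1)] by (simp add: flip: One_fract_def)
    next
      case False
      then obtain i where i: "Poly_Mapping.lookup m i \<noteq> 0"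
        by (metis lookup_zero poly_mapping_eqI)
      define m' where "m' = m - Poly_Mapping.single i 1"
      have m: "m = Poly_Mapping.single i 1 + m'"
        using i by (intro poly_mapping_eqI) (auto simp: m'_def lookup_add lookup_minus lookup_single when_def)
      have "(\<Sum>j\<in>UNIV. Poly_Mapping.lookup m j) = 1 + (\<Sum>j\<in>UNIV. Poly_Mapping.lookup m' j)"
        by (simp add: m lookup_add sum.distrib lookup_single when_def)
      then have IH: "\<phi> (Fract (Poly_Mapping.single m' 1) 1) = \<psi> (Fract (Poly_Mapping.single m' 1) 1)"
        using less by simp
      have eq: "Fract (Poly_Mapping.single m 1) 1 = y_var i * Fract (Poly_Mapping.single m' 1) 1"
        by (simp add: y_var_def mult_single m)
      have mem: "y_var i \<in> subfree" "Fract (Poly_Mapping.single m' 1) 1 \<in> subfree"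
        unfolding y_var_def by (auto intro!: sf nonneg_mpoly_single)
      show ?thesis
        unfolding eq using mem IH \<phi> \<psi> by (simp add: trop_hom_def del: mult_fract)
    qed
  qed
  show "nonneg_mpoly f \<Longrightarrow> \<phi> (Fract f 1) = \<psi> (Fract f 1)"
  proof (induction "nat (\<Sum>m\<in>Poly_Mapping.keys f. Poly_Mapping.lookup f m)" arbitrary: f rule: less_induct)
    case less
    then have "Poly_Mapping.keys f \<noteq> {}"
      by (simp add: nonneg_mpoly_def)
    then obtain m where m: "m \<in> Poly_Mapping.keys f"
      by blast
    define g where "g = f - Poly_Mapping.single m 1"
    have f: "f = Poly_Mapping.single m 1 + g"
      by (simp add: g_def)
    have fm: "0 < Poly_Mapping.lookup f m"
      using less.prems m by (metis nonneg_mpoly_def in_keys_iff order_le_less)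
    have lg: "Poly_Mapping.lookup g l = Poly_Mapping.lookup f l - (if l = m then 1 else 0)" for l
      by (simp add: g_def lookup_minus lookup_single when_def)
    show ?case
    proof (cases "g = 0")
      case True
      then show ?thesis using mono f by simp
    next
      case False
      have g: "nonneg_mpoly g"
        using False fm less.prems by (auto simp: nonneg_mpoly_def lg)
      have sub: "Poly_Mapping.keys g \<subseteq> Poly_Mapping.keys f"
        using m by (auto simp: in_keys_iff lg split: if_splits)
      have "(\<Sum>l\<in>Poly_Mapping.keys g. Poly_Mapping.lookup g l) = (\<Sum>l\<in>Poly_Mapping.keys f. Poly_Mapping.lookup g l)"
        using sub by (intro sum.mono_neutral_left) (auto simp: in_keys_iff)
      also have "\<dots> = (\<Sum>l\<in>Poly_Mapping.keys f. Poly_Mapping.lookup f l) - 1"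
        using m by (simp add: lg sum_subtractf)
      finally have "(\<Sum>l\<in>Poly_Mapping.keys g. Poly_Mapping.lookup g l) = (\<Sum>l\<in>Poly_Mapping.keys f. Poly_Mapping.lookup f l) - 1" .
      moreover have "0 \<le> (\<Sum>l\<in>Poly_Mapping.keys g. Poly_Mapping.lookup g l)"
        using g by (intro sum_nonneg) (auto simp: nonneg_mpoly_def)
      ultimately have IH: "\<phi> (Fract g 1) = \<psi> (Fract g 1)"
        using less.hyps[of g] g by linarith
      have eq: "Fract f 1 = Fract (Poly_Mapping.single m 1) 1 + Fract g 1"
        by (simp add: f)
      have mem: "Fract (Poly_Mapping.single m 1) 1 \<in> subfree" "Fract g 1 \<in> subfree"
        by (auto intro!: sf nonneg_mpoly_single g)
      show ?thesis
        unfolding eq using mem IH mono \<phi>(1) \<psi>(1) by (simp add: trop_hom_def del: add_fract)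
    qed
  qed
qed

lemma trop_hom_ex1:
  "\<exists>!\<phi> :: 'n::{finite,linorder} rat_fun \<Rightarrow> 'n int_vec.
     \<phi> \<in> extensional subfree \<and> trop_hom \<phi> \<and> (\<forall>i. \<phi> (y_var i) = axis i 1)"
proof -
  define R where "R h v \<longleftrightarrow> (\<exists>f g. nonneg_mpoly f \<and> nonneg_mpoly g \<and> h = Fract f g \<and> v = min_exp f - min_exp g)"
    for h :: "'n rat_fun" and v
  define \<phi> where "\<phi> = restrict (\<lambda>h. SOME v. R h v) subfree"
  have \<phi>_Fract: "\<phi> (Fract f g) = min_exp f - min_exp g" if "nonneg_mpoly f" "nonneg_mpoly g" for f g
  proof -
    have *: "R (Fract f g) (min_exp f - min_exp g)"
      using that by (auto simp: R_def)
    then have "R (Fract f g) (SOME v. R (Fract f g) v)"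
      by (rule someI)
    then obtain f' g' where f'g': "nonneg_mpoly f'" "nonneg_mpoly g'" "Fract f g = Fract f' g'"
      "(SOME v. R (Fract f g) v) = min_exp f' - min_exp g'"
      unfolding R_def by blast
    then have "f * g' = f' * g"
      using that by (subst (asm) eq_fract) (auto simp: nonneg_mpoly_def)
    then have eq: "min_exp f + min_exp g' = min_exp f' + min_exp g"
      using that f'g' by (metis min_exp_mult)
    moreover have "Fract f g \<in> subfree"
      using that by (auto simp: subfree_def)
    moreover have "min_exp f - min_exp g = min_exp f' - min_exp g'"
    proof -
      have "min_exp f - min_exp g = (min_exp f + min_exp g') - (min_exp g + min_exp g')"
        by simp
      also have "\<dots> = min_exp f' - min_exp g'"
        unfolding eq by simp
      finally show ?thesis .
    qed
    ultimately show ?thesis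
      using f'g' by (simp add: \<phi>_def)
  qed
  have "trop_hom \<phi>"
    unfolding trop_hom_def
  proof (intro ballI)
    fix h h' :: "'n rat_fun" assume "h \<in> subfree" "h' \<in> subfree"
    then obtain f g f' g' where nn: "nonneg_mpoly f" "nonneg_mpoly g" "nonneg_mpoly f'" "nonneg_mpoly g'"
      and h: "h = Fract f g" "h' = Fract f' g'"
      by (auto simp: subfree_def)
    have nz: "g \<noteq> 0" "g' \<noteq> 0" using nn by (auto simp: nonneg_mpoly_def)
    show "\<phi> (h * h') = \<phi> h + \<phi> h' \<and> \<phi> (h + h') = (\<chi> i. min (\<phi> h $ i) (\<phi> h' $ i))"
      using nn nz by (auto simp: h \<phi>_Fract nonneg_mpoly_mult nonneg_mpoly_add min_exp_mult min_exp_add vec_eq_iff)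
  qed
  moreover have "\<phi> (y_var i) = axis i 1" for i
  proof -
    have "min_exp (Poly_Mapping.single m 1) = (\<chi> i. int (Poly_Mapping.lookup m i))" for m :: "'n \<Rightarrow>\<^sub>0 nat"
      by (simp add: min_exp_def)
    from this[of "Poly_Mapping.single i 1"] this[of 0]
    have "\<phi> (y_var i) = (\<chi> j. int (Poly_Mapping.lookup (Poly_Mapping.single i 1) j))"
      unfolding y_var_def by (subst \<phi>_Fract) (auto simp: nonneg_mpoly_single nonneg_mpoly_1 vec_eq_iff single_one)
    then show ?thesis
      by (auto simp: vec_eq_iff axis_def lookup_single when_def)
  qed
  moreover have "\<phi> \<in> extensional subfree"
    by (simp add: \<phi>_def)
  moreover have "\<psi> = \<phi>" if \<psi>: "\<psi> \<in> extensional subfree" "trop_hom \<psi>" "\<forall>i. \<psi> (y_var i) = axis i 1" for \<psi>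
  proof (rule extensionalityI)
    show "\<psi> \<in> extensional subfree" "\<phi> \<in> extensional subfree" by fact+
    fix h :: "'n rat_fun" assume "h \<in> subfree"
    then obtain f g where nn: "nonneg_mpoly f" "nonneg_mpoly g" and h: "h = Fract f g"
      by (auto simp: subfree_def)
    have *: "\<theta> h + \<theta> (Fract g 1) = \<theta> (Fract f 1)" if "trop_hom \<theta>" for \<theta>
    proof -
      have "Fract g 1 \<in> subfree"
        using nn nonneg_mpoly_1 unfolding subfree_def by blast
      then have "\<theta> (h * Fract g 1) = \<theta> h + \<theta> (Fract g 1)"
        using that \<open>h \<in> subfree\<close> unfolding trop_hom_def by blast
      moreover have "h * Fract g 1 = Fract f 1"
        using nn by (auto simp: h nonneg_mpoly_def eq_fract)
      ultimately show ?thesis by simp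
    qed
    show "\<psi> h = \<phi> h"
      using *[OF \<psi>(2)] *[OF \<open>trop_hom \<phi>\<close>] nn
        trop_hom_unique_on_polys[OF \<psi>(2) _ \<open>trop_hom \<phi>\<close> \<open>\<And>i. \<phi> (y_var i) = axis i 1\<close>] \<psi>(3)
      by (metis add_right_cancel)
  qed
  ultimately show ?thesis by blast
qed

definition pi_trop :: "'n::{finite,linorder} rat_fun \<Rightarrow> 'n int_vec" where
  "pi_trop = (THE \<phi>. \<phi> \<in> extensional subfree \<and> trop_hom \<phi> \<and> (\<forall>i. \<phi> (y_var i) = axis i 1))"

lemma subfree_closed:
  assumes "f \<in> subfree" "g \<in> subfree"
  shows "f + g \<in> subfree" "f * g \<in> subfree" "inverse f \<in> subfree" "f \<noteq> 0"
proof -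
  obtain a b a' b' where nn: "nonneg_mpoly a" "nonneg_mpoly b" "nonneg_mpoly a'" "nonneg_mpoly b'"
    and fg: "f = Fract a b" "g = Fract a' b'"
    using assms by (auto simp: subfree_def)
  have nz: "a \<noteq> 0" "b \<noteq> 0" "b' \<noteq> 0"
    using nn by (auto simp: nonneg_mpoly_def)
  show "f * g \<in> subfree" "inverse f \<in> subfree"
    using nn unfolding fg mult_fract inverse_fract subfree_def by (blast intro: nonneg_mpoly_mult)+
  show "f + g \<in> subfree"
    using nn unfolding fg add_fract[OF nz(2,3)] subfree_def
    by (blast intro: nonneg_mpoly_mult nonneg_mpoly_add)
  show "f \<noteq> 0"
    using nz by (simp add: fg Zero_fract_def eq_fract)
qed

lemma subfree_1: "1 \<in> subfree"
  unfolding One_fract_def subfree_def using nonneg_mpoly_1 by blast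

lemma subfree_powi: "f \<in> subfree \<Longrightarrow> f powi m \<in> subfree"
proof -
  assume f: "f \<in> subfree"
  have "g ^ l \<in> subfree" if "g \<in> subfree" for g :: "'a rat_fun" and l
    by (induction l) (auto intro: subfree_1 subfree_closed that)
  then show ?thesis
    using f by (simp add: power_int_def subfree_closed(3))
qed

lemma y_seq_subfree: "y_seq B k s i \<in> subfree"
proof (induction s arbitrary: i)
  case 0
  show ?case
    unfolding y_seq.simps y_var_def subfree_def
    using nonneg_mpoly_1 nonneg_mpoly_single[of 1] by (metis (mono_tags, lifting) mem_Collect_eq zero_less_one)
next
  case (Suc s)
  then show ?case
    by (simp add: y_mutation_def) (intro conjI impI subfree_closed subfree_powi subfree_1 Suc)
qed

definition is_tropical_sign ::
    "'n int_mat \<Rightarrow> (nat \<Rightarrow> 'n::{finite,linorder}) \<Rightarrow> nat \<Rightarrow> int \<Rightarrow> bool" where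
  "is_tropical_sign B k s \<epsilon> \<longleftrightarrow>
     (let c = pi_trop (y_seq B k s (k s)) in
        c \<noteq> 0 \<and> (\<epsilon> = 1 \<and> (\<forall>i. 0 \<le> c $ i) \<or> \<epsilon> = - 1 \<and> (\<forall>i. c $ i \<le> 0)))"

definition tropical_sign_sequence ::
    "'n int_mat \<Rightarrow> (nat \<Rightarrow> 'n::{finite,linorder}) \<Rightarrow> nat \<Rightarrow> (nat \<Rightarrow> int) \<Rightarrow> bool" where
  "tropical_sign_sequence B k T \<epsilon> \<longleftrightarrow> (\<forall>s<T. is_tropical_sign B k s (\<epsilon> s))"


section \<open>Hamiltonian flows\<close>

text \<open>A point of the phase space is a pair \<open>(u, p)\<close>.\<close>

type_synonym 'n phase = "(real ^ 'n) \<times> (real ^ 'n)"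

definition partial_u :: "('n::finite phase \<Rightarrow> real) \<Rightarrow> 'n \<Rightarrow> 'n phase \<Rightarrow> real" where
  "partial_u H i x = deriv (\<lambda>h. H (fst x + h *\<^sub>R axis i 1, snd x)) 0"

definition partial_p :: "('n::finite phase \<Rightarrow> real) \<Rightarrow> 'n \<Rightarrow> 'n phase \<Rightarrow> real" where
  "partial_p H i x = deriv (\<lambda>h. H (fst x, snd x + h *\<^sub>R axis i 1)) 0"

definition hamilton_solution ::
    "('n::finite phase \<Rightarrow> real) \<Rightarrow> real set \<Rightarrow> (real \<Rightarrow> 'n phase) \<Rightarrow> bool" where
  "hamilton_solution H I \<gamma> \<longleftrightarrow>
     (\<forall>t\<in>I. (\<gamma> has_vector_derivative
                (\<chi> i. partial_p H i (\<gamma> t), \<chi> i. - partial_u H i (\<gamma> t))) (at t within I))"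

definition time_one_flow :: "('n::finite phase \<Rightarrow> real) \<Rightarrow> 'n phase \<Rightarrow> 'n phase" where
  "time_one_flow H x = (THE z. \<exists>\<gamma>. hamilton_solution H {0..1} \<gamma> \<and> \<gamma> 0 = x \<and> \<gamma> 1 = z)"


section \<open>Signed mutations\<close>

text \<open>
  The dilogarithm, for arguments \<open>x \<le> 0\<close>; the junk value of the integrand at \<open>z = 0\<close> is
  irrelevant for the integral.
\<close>

definition Li2 :: "real \<Rightarrow> real" where
  "Li2 x = - integral {0..-x} (\<lambda>z. ln (1 + z) / z)"

definition w_coord :: "'n int_mat \<Rightarrow> 'n::finite phase \<Rightarrow> 'n \<Rightarrow> real" where
  "w_coord B x i = (\<Sum>j\<in>UNIV. of_int (B $ j $ i) * fst x $ j)"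

definition y_coord :: "'n int_vec \<Rightarrow> 'n int_mat \<Rightarrow> 'n::finite phase \<Rightarrow> 'n \<Rightarrow> real" where
  "y_coord d B x i = exp (of_int (d $ i) * snd x $ i + w_coord B x i)"

definition hamiltonian ::
    "'n int_vec \<Rightarrow> 'n int_mat \<Rightarrow> 'n \<Rightarrow> int \<Rightarrow> 'n::finite phase \<Rightarrow> real" where
  "hamiltonian d B k \<epsilon> x =
     of_int \<epsilon> / (2 * of_int (d $ k)) * Li2 (- (y_coord d B x k powi \<epsilon>))"

lemma Li2_has_real_derivative:
  assumes "x < 0"
  shows "(Li2 has_real_derivative - ln (1 - x) / x) (at x)"
proof -
  define g :: "real \<Rightarrow> real" where "g z = (if z = 0 then 1 else ln (1 + z) / z)" for z
  have "isCont g z" if "0 \<le> z" for z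
  proof (cases "z = 0")
    case True
    have "((\<lambda>h. (ln (1 + h) - ln 1) / h) \<longlongrightarrow> 1) (at (0::real))"
      using DERIV_ln[of 1] by (simp add: DERIV_def)
    then have "((\<lambda>z. ln (1 + z) / z) \<longlongrightarrow> 1) (at (0::real))"
      by simp
    moreover have "eventually (\<lambda>z. g z = ln (1 + z) / z) (at 0)"
      by (auto simp: g_def eventually_at_filter)
    ultimately have "(g \<longlongrightarrow> 1) (at 0)"
      by (simp add: filterlim_cong)
    then show ?thesis
      by (simp add: True isCont_def g_def)
  next
    case False
    have "isCont (\<lambda>z. ln (1 + z) / z) z"
      using that False by (auto intro!: continuous_intros)
    moreover have "eventually (\<lambda>z. g z = ln (1 + z) / z) (nhds z)"
      using False t1_space_nhds[of z 0] by (auto simp: g_def elim!: eventually_mono)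
    ultimately show ?thesis
      by (simp add: isCont_cong)
  qed
  then have cont: "continuous_on {0..- x + 1} g"
    by (intro continuous_at_imp_continuous_on) auto
  have "((\<lambda>v. integral {0..v} g) has_real_derivative g (- x)) (at (- x) within {0..- x + 1})"
    using assms by (intro integral_has_real_derivative cont) auto
  then have "((\<lambda>v. integral {0..v} g) has_real_derivative g (- x)) (at (- x))"
    using assms by (subst (asm) at_within_Icc_at) auto
  then have "((\<lambda>v. - integral {0..- v} g) has_real_derivative - (g (- x) * - 1)) (at x)"
    by (intro DERIV_minus DERIV_chain2[of "\<lambda>v. integral {0..v} g"] derivative_eq_intros) auto
  moreover have "Li2 = (\<lambda>v. - integral {0..- v} g)"
    unfolding Li2_def
    by (intro ext arg_cong[where f = uminus] integral_spike[of "{0}"]) (auto simp: g_def)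
  ultimately show ?thesis
    using assms by (simp add: g_def)
qed

text \<open>
  Hamilton's equations for this Hamiltonian read \<open>x' = ham_speed x *\<^sub>R ham_dir\<close>, and the speed is
  constant along \<open>ham_dir\<close>, so every solution is affine and the time one flow is well defined.
\<close>

definition ham_speed :: "'n::finite int_vec \<Rightarrow> 'n int_mat \<Rightarrow> 'n \<Rightarrow> int \<Rightarrow> 'n phase \<Rightarrow> real" where
  "ham_speed d B k \<epsilon> x = ln (1 + y_coord d B x k powi \<epsilon>) / 2"

definition ham_dir :: "'n::finite int_vec \<Rightarrow> 'n int_mat \<Rightarrow> 'n \<Rightarrow> 'n phase" where
  "ham_dir d B k = (axis k (- 1), \<chi> i. of_int (B $ i $ k) / of_int (d $ k))"

lemma exp_powi_sign: "\<epsilon> = 1 \<or> \<epsilon> = - 1 \<Longrightarrow> exp (a::real) powi \<epsilon> = exp (of_int \<epsilon> * a)"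
  by (auto simp: exp_minus)

lemma hamiltonian_line_derivative:
  assumes "\<epsilon> = 1 \<or> \<epsilon> = - 1"
  shows "((\<lambda>h. hamiltonian d B k \<epsilon> (fst x + h *\<^sub>R a, snd x + h *\<^sub>R b)) has_real_derivative
           - (of_int (d $ k) * b $ k + (\<Sum>j\<in>UNIV. of_int (B $ j $ k) * a $ j))
              * ham_speed d B k \<epsilon> x / of_int (d $ k)) (at 0)"
proof -
  define E where "E = of_int (d $ k) * snd x $ k + w_coord B x k"
  define c where "c = of_int (d $ k) * b $ k + (\<Sum>j\<in>UNIV. of_int (B $ j $ k) * a $ j)"
  define Z where "Z = exp (of_int \<epsilon> * E)"
  have eq: "hamiltonian d B k \<epsilon> (fst x + h *\<^sub>R a, snd x + h *\<^sub>R b)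
      = of_int \<epsilon> / (2 * of_int (d $ k)) * Li2 (- exp (of_int \<epsilon> * (E + h * c)))" for h
    unfolding hamiltonian_def y_coord_def exp_powi_sign[OF assms]
    by (simp add: w_coord_def E_def c_def algebra_simps sum.distrib sum_distrib_left)
  have ee: "of_int \<epsilon> * of_int \<epsilon> = (1::real)"
    using assms by auto
  have Zpos: "Z > 0" by (simp add: Z_def)
  have 1: "((\<lambda>h. - exp (of_int \<epsilon> * (E + h * c))) has_real_derivative - (Z * (of_int \<epsilon> * c))) (at 0)"
    by (auto intro!: derivative_eq_intros simp: Z_def)
  have "(Li2 has_real_derivative - ln (1 - (- Z)) / (- Z)) (at (- Z))"
    using Zpos by (intro Li2_has_real_derivative) simp
  then have 2: "((\<lambda>h. Li2 (- exp (of_int \<epsilon> * (E + h * c)))) has_real_derivative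
      - ln (1 - (- Z)) / (- Z) * - (Z * (of_int \<epsilon> * c))) (at 0)"
    using 1 by (intro DERIV_chain2[of Li2]) (auto simp: Z_def)
  have "((\<lambda>h. hamiltonian d B k \<epsilon> (fst x + h *\<^sub>R a, snd x + h *\<^sub>R b)) has_real_derivative
      of_int \<epsilon> / (2 * of_int (d $ k)) * (- ln (1 - (- Z)) / (- Z) * - (Z * (of_int \<epsilon> * c)))) (at 0)"
    unfolding eq by (intro DERIV_cmult 2)
  also have "of_int \<epsilon> / (2 * of_int (d $ k)) * (- ln (1 - (- Z)) / (- Z) * - (Z * (of_int \<epsilon> * c)))
      = - ((of_int \<epsilon> * of_int \<epsilon>) * c * ln (1 + Z) / (2 * of_int (d $ k)))"
    using Zpos by simp
  also have "\<dots> = - c * ham_speed d B k \<epsilon> x / of_int (d $ k)"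
    unfolding ee by (simp add: ham_speed_def y_coord_def exp_powi_sign[OF assms] Z_def E_def)
  finally show ?thesis
    by (simp add: c_def)
qed

lemma hamilton_vector_field:
  assumes "\<epsilon> = 1 \<or> \<epsilon> = - 1" "0 < d $ k"
  shows "(\<chi> i. partial_p (hamiltonian d B k \<epsilon>) i x, \<chi> i. - partial_u (hamiltonian d B k \<epsilon>) i x)
     = ham_speed d B k \<epsilon> x *\<^sub>R ham_dir d B k"
proof -
  have "partial_p (hamiltonian d B k \<epsilon>) i x = (if i = k then - ham_speed d B k \<epsilon> x else 0)" for i
    using DERIV_imp_deriv[OF hamiltonian_line_derivative[OF assms(1), of d B k x 0 "axis i 1"]] assms(2)
    by (simp add: partial_p_def axis_def)
  moreover have "partial_u (hamiltonian d B k \<epsilon>) i x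
      = - of_int (B $ i $ k) * ham_speed d B k \<epsilon> x / of_int (d $ k)" for i
    using DERIV_imp_deriv[OF hamiltonian_line_derivative[OF assms(1), of d B k x "axis i 1" 0]] assms(2)
    by (simp add: partial_u_def axis_def if_distrib[of "(*) _"] cong: if_cong)
  ultimately show ?thesis
    by (auto simp: ham_dir_def vec_eq_iff axis_def)
qed

lemma ham_speed_const:
  assumes "0 < d $ k"
  shows "ham_speed d B k \<epsilon> (x + c *\<^sub>R ham_dir d B k) = ham_speed d B k \<epsilon> x"
proof -
  have "y_coord d B (x + c *\<^sub>R ham_dir d B k) k = y_coord d B x k"
    using assms
    by (simp add: y_coord_def w_coord_def ham_dir_def axis_def algebra_simps sum.distrib
        sum_negf if_distrib[of "(*) _"] cong: if_cong)
  then show ?thesis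
    by (simp add: ham_speed_def)
qed

lemma hamilton_solution_iff:
  assumes "\<epsilon> = 1 \<or> \<epsilon> = - 1" "0 < d $ k" "a \<le> b"
  shows "hamilton_solution (hamiltonian d B k \<epsilon>) {a..b} \<gamma> \<longleftrightarrow>
     (\<forall>t\<in>{a..b}. \<gamma> t = \<gamma> a + ((t - a) * ham_speed d B k \<epsilon> (\<gamma> a)) *\<^sub>R ham_dir d B k)"
    (is "?L \<longleftrightarrow> ?R")
proof
  assume ?L
  then have der: "(\<gamma> has_vector_derivative ham_speed d B k \<epsilon> (\<gamma> t) *\<^sub>R ham_dir d B k) (at t within {a..b})"
    if "t \<in> {a..b}" for t
    using that assms by (simp add: hamilton_solution_def hamilton_vector_field)
  define \<theta> :: "'a phase \<Rightarrow> real" where "\<theta> x = of_int (d $ k) * snd x $ k + w_coord B x k" for x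
  have lin: "bounded_linear \<theta>"
    unfolding \<theta>_def w_coord_def
    by (intro bounded_linear_add bounded_linear_sum bounded_linear_const_mult
        bounded_linear_compose[OF bounded_linear_vec_nth] bounded_linear_fst bounded_linear_snd)
  have "\<theta> (ham_dir d B k) = 0"
    using assms(2)
    by (simp add: \<theta>_def w_coord_def ham_dir_def axis_def if_distrib[of "(*) _"] cong: if_cong)
  then have "((\<lambda>t. \<theta> (\<gamma> t)) has_vector_derivative 0) (at t within {a..b})" if "t \<in> {a..b}" for t
    using bounded_linear.has_vector_derivative[OF lin der[OF that]]
    by (simp add: linear_simps(5)[OF lin])
  then have "\<theta> (\<gamma> t) = \<theta> (\<gamma> a)" if "t \<in> {a..b}" for t
    using that assms(3) has_vector_derivative_zero_constant[of "{a..b}" "\<lambda>t. \<theta> (\<gamma> t)"]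
    by (metis atLeastAtMost_iff convex_real_interval(5) order_refl)
  moreover have "ham_speed d B k \<epsilon> x = ln (1 + exp (\<theta> x) powi \<epsilon>) / 2" for x
    by (simp add: ham_speed_def y_coord_def \<theta>_def)
  ultimately have speed: "ham_speed d B k \<epsilon> (\<gamma> t) = ham_speed d B k \<epsilon> (\<gamma> a)"
    if "t \<in> {a..b}" for t
    using that by metis
  have der0: "((\<lambda>t. \<gamma> t - ((t - a) * ham_speed d B k \<epsilon> (\<gamma> a)) *\<^sub>R ham_dir d B k) has_vector_derivative 0)
      (at t within {a..b})" if "t \<in> {a..b}" for t
    using der[OF that] unfolding speed[OF that] by (auto intro!: derivative_eq_intros)
  obtain z where z: "\<And>t. t \<in> {a..b} \<Longrightarrow>
      \<gamma> t - ((t - a) * ham_speed d B k \<epsilon> (\<gamma> a)) *\<^sub>R ham_dir d B k = z"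
    by (rule has_vector_derivative_zero_constant[OF convex_real_interval(5) der0]) auto
  have "z = \<gamma> a"
    using z[of a] assms(3) by simp
  with z show ?R
    by (metis diff_eq_eq)
next
  assume R: ?R
  let ?v = "ham_speed d B k \<epsilon> (\<gamma> a) *\<^sub>R ham_dir d B k"
  have "(\<gamma> has_vector_derivative ham_speed d B k \<epsilon> (\<gamma> t) *\<^sub>R ham_dir d B k) (at t within {a..b})"
    if t: "t \<in> {a..b}" for t
  proof -
    have line: "((\<lambda>t. \<gamma> a + (t - a) *\<^sub>R ?v) has_vector_derivative ?v) (at t within {a..b})"
      by (auto intro!: derivative_eq_intros)
    have "\<gamma> r = \<gamma> a + (r - a) *\<^sub>R ?v" if "r \<in> {a..b}" for r
      using bspec[OF R that] by (simp only: scaleR_scaleR)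
    then have "(\<gamma> has_vector_derivative ?v) (at t within {a..b})"
      by (rule has_vector_derivative_transform[OF t _ line])
    moreover have "ham_speed d B k \<epsilon> (\<gamma> t) = ham_speed d B k \<epsilon> (\<gamma> a)"
      by (subst bspec[OF R t]) (rule ham_speed_const[OF assms(2)])
    ultimately show ?thesis by simp
  qed
  then show ?L
    using assms by (simp add: hamilton_solution_def hamilton_vector_field)
qed

lemma time_one_flow_ex1:
  assumes "\<epsilon> = 1 \<or> \<epsilon> = - 1" "0 < d $ k"
  shows "\<exists>!z. \<exists>\<gamma>. hamilton_solution (hamiltonian d B k \<epsilon>) {0..1} \<gamma> \<and> \<gamma> 0 = x \<and> \<gamma> 1 = z"
proof (rule ex1I[of _ "x + ham_speed d B k \<epsilon> x *\<^sub>R ham_dir d B k"])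
  show "\<exists>\<gamma>. hamilton_solution (hamiltonian d B k \<epsilon>) {0..1} \<gamma> \<and> \<gamma> 0 = x
      \<and> \<gamma> 1 = x + ham_speed d B k \<epsilon> x *\<^sub>R ham_dir d B k"
    by (rule exI[of _ "\<lambda>t. x + (t * ham_speed d B k \<epsilon> x) *\<^sub>R ham_dir d B k"])
      (simp add: hamilton_solution_iff[OF assms])
next
  fix z assume "\<exists>\<gamma>. hamilton_solution (hamiltonian d B k \<epsilon>) {0..1} \<gamma> \<and> \<gamma> 0 = x \<and> \<gamma> 1 = z"
  then obtain \<gamma> where "hamilton_solution (hamiltonian d B k \<epsilon>) {0..1} \<gamma>" and \<gamma>: "\<gamma> 0 = x" "\<gamma> 1 = z"
    by blast
  then have "\<forall>t\<in>{0..1}. \<gamma> t = \<gamma> 0 + ((t - 0) * ham_speed d B k \<epsilon> (\<gamma> 0)) *\<^sub>R ham_dir d B k"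
    using hamilton_solution_iff[OF assms, where a = 0 and b = 1] by simp
  from bspec[OF this, of 1] show "z = x + ham_speed d B k \<epsilon> x *\<^sub>R ham_dir d B k"
    by (simp add: \<gamma>)
qed

definition rho ::
    "'n int_vec \<Rightarrow> 'n int_mat \<Rightarrow> 'n \<Rightarrow> int \<Rightarrow> 'n::finite phase \<Rightarrow> 'n phase" where
  "rho d B k \<epsilon> = time_one_flow (hamiltonian d B k \<epsilon>)"

definition tau :: "'n int_mat \<Rightarrow> 'n \<Rightarrow> int \<Rightarrow> 'n::finite phase \<Rightarrow> 'n phase" where
  "tau B k \<epsilon> x =
     (\<chi> i. if i = k
           then - fst x $ k + (\<Sum>j\<in>UNIV. of_int (pos_part (- \<epsilon> * B $ j $ k)) * fst x $ j)
           else fst x $ i,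
      \<chi> i. if i = k
           then - snd x $ k
           else snd x $ i + of_int (pos_part (- \<epsilon> * B $ i $ k)) * snd x $ k)"

definition signed_mutation ::
    "'n int_vec \<Rightarrow> 'n int_mat \<Rightarrow> 'n \<Rightarrow> int \<Rightarrow> 'n::finite phase \<Rightarrow> 'n phase" where
  "signed_mutation d B k \<epsilon> = tau B k \<epsilon> \<circ> rho d B k \<epsilon>"

primrec phase_seq ::
    "'n int_vec \<Rightarrow> 'n int_mat \<Rightarrow> (nat \<Rightarrow> 'n) \<Rightarrow> (nat \<Rightarrow> int) \<Rightarrow> 'n::finite phase \<Rightarrow> nat \<Rightarrow> 'n phase"
where
  "phase_seq d B k \<epsilon> x 0 = x"
| "phase_seq d B k \<epsilon> x (Suc s) =
     signed_mutation d (B_seq B k s) (k s) (\<epsilon> s) (phase_seq d B k \<epsilon> x s)"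

definition sigma_periodic ::
    "'n int_vec \<Rightarrow> 'n int_mat \<Rightarrow> (nat \<Rightarrow> 'n) \<Rightarrow> (nat \<Rightarrow> int) \<Rightarrow> nat \<Rightarrow> ('n::finite \<Rightarrow> 'n) \<Rightarrow> bool" where
  "sigma_periodic d B k \<epsilon> T \<sigma> \<longleftrightarrow>
     (\<forall>i j. B_seq B k T $ inv \<sigma> i $ inv \<sigma> j = B $ i $ j) \<and>
     (\<forall>x i. fst (phase_seq d B k \<epsilon> x T) $ inv \<sigma> i = fst x $ i \<and>
            snd (phase_seq d B k \<epsilon> x T) $ inv \<sigma> i = snd x $ i)"


section \<open>The piecewise Hamiltonian flow and its action\<close>

text \<open>
  \<open>x s\<close> is the point \<open>(u[s], p[s])\<close>, and \<open>\<gamma> s\<close> is the part of the flow on \<open>[s, s + 1]\<close>, written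
  in the \<open>s\<close>-th canonical coordinates.
\<close>

definition hamiltonian_flow ::
    "'n int_vec \<Rightarrow> 'n int_mat \<Rightarrow> (nat \<Rightarrow> 'n) \<Rightarrow> (nat \<Rightarrow> int) \<Rightarrow> nat \<Rightarrow>
     (nat \<Rightarrow> 'n::finite phase) \<Rightarrow> (nat \<Rightarrow> real \<Rightarrow> 'n phase) \<Rightarrow> bool" where
  "hamiltonian_flow d B k \<epsilon> T x \<gamma> \<longleftrightarrow> (\<forall>s<T.
     hamilton_solution (hamiltonian d (B_seq B k s) (k s) (\<epsilon> s)) {real s..real (Suc s)} (\<gamma> s) \<and>
     \<gamma> s (real s) = x s \<and>
     x (Suc s) = tau (B_seq B k s) (k s) (\<epsilon> s) (\<gamma> s (real (Suc s))))"

definition lagrangian ::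
    "'n int_vec \<Rightarrow> 'n int_mat \<Rightarrow> (nat \<Rightarrow> 'n) \<Rightarrow> (nat \<Rightarrow> int) \<Rightarrow>
     (nat \<Rightarrow> real \<Rightarrow> 'n::finite phase) \<Rightarrow> nat \<Rightarrow> real \<Rightarrow> real" where
  "lagrangian d B k \<epsilon> \<gamma> s t =
     vector_derivative (\<lambda>r. fst (\<gamma> s r) $ k s) (at t within {real s..real (Suc s)})
       * snd (\<gamma> s t) $ k s
     - hamiltonian d (B_seq B k s) (k s) (\<epsilon> s) (\<gamma> s t)"

definition action_integral ::
    "'n int_vec \<Rightarrow> 'n int_mat \<Rightarrow> (nat \<Rightarrow> 'n) \<Rightarrow> (nat \<Rightarrow> int) \<Rightarrow> nat \<Rightarrow>
     (nat \<Rightarrow> real \<Rightarrow> 'n::finite phase) \<Rightarrow> real" where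
  "action_integral d B k \<epsilon> T \<gamma> =
     (\<Sum>s<T. integral {real s..real (Suc s)} (lagrangian d B k \<epsilon> \<gamma> s))"

end

theory Submission
  imports Defs "HOL-Real_Asymp.Real_Asymp"
begin

text \<open>
  Regard the action as a function of the initial point.  It is constant because of the
  symplectic geometry, and its value is zero because of the tropical signs.

  Along each unit of time the flow moves on a straight line with constant Hamiltonian, so the
  action of a step is an explicit function \<open>step_action\<close> of the point where the step starts, and
  the whole action is a function \<open>total_action\<close> of the initial point.  As for every Hamiltonian
  flow, the differential of the action of a step is the change of the Liouville form
  \<open>p\<^sub>1 du\<^sub>1 + \<dots> + p\<^sub>n du\<^sub>n\<close> under the time one flow (\<open>liouville_rho\<close>).  The coordinate changes \<open>tau\<close>
  preserve the Liouville form: the matrix acting on \<open>p\<close> is the inverse transpose of the one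
  acting on \<open>u\<close> (\<open>liouville_tau\<close>).  Hence the differential of the whole action is the change of
  the Liouville form under the composite of all signed mutations.  Periodicity makes that
  composite a simultaneous permutation of the \<open>u\<close> and \<open>p\<close> coordinates, which preserves the form.
  So the action is the same for all initial points (\<open>total_action_const\<close>).

  It remains to find initial points with arbitrarily small action.  Start with all \<open>y\<close>-variables
  equal to \<open>exp (- r)\<close> and let \<open>r\<close> grow.  Up to a bounded error the orbit is then \<open>r\<close> times the
  orbit of the linear maps \<open>tau\<close> alone (\<open>phase_seq_near_trop_seq\<close>), and on that linear orbit the
  logarithms of the \<open>y\<close>-variables mutate exactly as the tropical exponents of the formal
  \<open>y\<close>-variables do (\<open>log_y_trop_seq\<close>).  Since \<open>\<epsilon>\<close> is the tropical sign, the variable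
  \<open>y powi \<epsilon>\<close> that drives each step is \<open>O(exp (- r))\<close>.  This keeps the error bounded in the next
  step, and it makes the speed and the Hamiltonian decay exponentially, whereas the momenta grow
  at most linearly in \<open>r\<close>.  The action therefore tends to zero (\<open>total_action_tendsto_0\<close>).
\<close>

section \<open>Mutation of skew-symmetrizable matrices\<close>

lemma pos_part_mult_left: "0 \<le> c \<Longrightarrow> c * pos_part a = pos_part (c * a)"
  by (auto simp: pos_part_def max_def mult_le_0_iff zero_le_mult_iff)

lemma skew_symmetrizer_pos: "skew_symmetrizer d B \<Longrightarrow> 0 < d $ i"
  by (simp add: skew_symmetrizer_def)

lemma skew_symmetrizer_swap: "skew_symmetrizer d B \<Longrightarrow> d $ i * B $ i $ j = - (d $ j * B $ j $ i)"
  unfolding skew_symmetrizer_def by blast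

lemma skew_symmetrizer_diag: "skew_symmetrizer d B \<Longrightarrow> B $ i $ i = 0"
proof -
  assume sk: "skew_symmetrizer d B"
  have "d $ i * B $ i $ i = 0"
    using skew_symmetrizer_swap[OF sk, of i i] by linarith
  then show ?thesis
    using skew_symmetrizer_pos[OF sk, of i] by simp
qed

lemma skew_symmetrizer_pos_part_swap:
  assumes "skew_symmetrizer d B"
  shows "d $ i * pos_part (- (a * B $ i $ j)) = d $ j * pos_part (a * B $ j $ i)"
proof -
  have "d $ i * (- (a * B $ i $ j)) = d $ j * (a * B $ j $ i)"
    using arg_cong[OF skew_symmetrizer_swap[OF assms, of i j], of "\<lambda>z. - (a * z)"]
    by (simp add: algebra_simps)
  then show ?thesis
    using skew_symmetrizer_pos[OF assms] by (simp add: pos_part_mult_left less_imp_le)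
qed

lemma skew_symmetrizer_mutation:
  assumes "skew_symmetrizer d B"
  shows "skew_symmetrizer d (matrix_mutation 1 k B)"
proof -
  note swap = skew_symmetrizer_swap[OF assms]
  note pswap = skew_symmetrizer_pos_part_swap[OF assms, where a = 1, simplified]
  let ?B = "matrix_mutation 1 k B"
  have "d $ i * ?B $ i $ j = - (d $ j * ?B $ j $ i)" for i j
  proof (cases "i = k \<or> j = k")
    case True
    then have eq: "?B $ i $ j = - B $ i $ j" "?B $ j $ i = - B $ j $ i"
      by (auto simp: matrix_mutation_def)
    then show ?thesis
      unfolding eq mult_minus_right swap[of i j] by simp
  next
    case False
    then have eq: "?B $ i $ j = B $ i $ j + pos_part (- B $ i $ k) * B $ k $ j + B $ i $ k * pos_part (B $ k $ j)"
      "?B $ j $ i = B $ j $ i + pos_part (- B $ j $ k) * B $ k $ i + B $ j $ k * pos_part (B $ k $ i)"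
      by (simp_all add: matrix_mutation_def)
    have 1: "d $ i * (pos_part (- B $ i $ k) * B $ k $ j) = - (d $ j * (B $ j $ k * pos_part (B $ k $ i)))"
      unfolding mult.assoc[symmetric] pswap[of i k]
      using arg_cong[OF swap[of k j], of "\<lambda>z. z * pos_part (B $ k $ i)"]
      by (simp add: algebra_simps)
    have 2: "d $ i * (B $ i $ k * pos_part (B $ k $ j)) = - (d $ j * (pos_part (- B $ j $ k) * B $ k $ i))"
      unfolding mult.assoc[symmetric] pswap[of j k] swap[of i k] by (simp add: algebra_simps)
    show ?thesis
      using 1 2 swap[of i j] unfolding eq distrib_left by linarith
  qed
  then show ?thesis
    unfolding skew_symmetrizer_def using skew_symmetrizer_pos[OF assms] by blast
qed

lemma skew_symmetrizer_B_seq: "skew_symmetrizer d B \<Longrightarrow> skew_symmetrizer d (B_seq B k s)"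
  by (induction s) (auto intro: skew_symmetrizer_mutation)


section \<open>One step of the flow\<close>

text \<open>
  The speed and the Hamiltonian of a step depend on the phase point only through this linear functional, which makes
  both the conservation laws and the growth estimates linear algebra.
\<close>
definition log_y :: "'n int_vec \<Rightarrow> 'n int_mat \<Rightarrow> 'n \<Rightarrow> 'n::finite phase \<Rightarrow> real" where
  "log_y d B i x = of_int (d $ i) * snd x $ i + w_coord B x i"

lemma bounded_linear_log_y: "bounded_linear (log_y d B i)"
  unfolding log_y_def w_coord_def
  by (intro bounded_linear_add bounded_linear_sum bounded_linear_const_mult
      bounded_linear_compose[OF bounded_linear_vec_nth] bounded_linear_fst bounded_linear_snd)

lemma ham_speed_eq_log_y:
  "\<epsilon> = 1 \<or> \<epsilon> = - 1 \<Longrightarrow> ham_speed d B k \<epsilon> x = ln (1 + exp (of_int \<epsilon> * log_y d B k x)) / 2"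
  by (simp add: ham_speed_def y_coord_def log_y_def exp_powi_sign)

lemma hamiltonian_eq_log_y:
  "\<epsilon> = 1 \<or> \<epsilon> = - 1 \<Longrightarrow>
     hamiltonian d B k \<epsilon> x = of_int \<epsilon> / (2 * of_int (d $ k)) * Li2 (- exp (of_int \<epsilon> * log_y d B k x))"
  by (simp add: hamiltonian_def y_coord_def log_y_def exp_powi_sign)

lemma log_y_ham_dir: "0 < d $ k \<Longrightarrow> log_y d B k (ham_dir d B k) = 0"
  by (simp add: log_y_def w_coord_def ham_dir_def axis_def if_distrib[of "(*) _"] cong: if_cong)

lemma hamiltonian_const:
  assumes "\<epsilon> = 1 \<or> \<epsilon> = - 1" "0 < d $ k"
  shows "hamiltonian d B k \<epsilon> (x + c *\<^sub>R ham_dir d B k) = hamiltonian d B k \<epsilon> x"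
  using assms
  by (simp add: hamiltonian_eq_log_y linear_simps[OF bounded_linear_log_y] log_y_ham_dir)

lemma rho_eq:
  assumes "\<epsilon> = 1 \<or> \<epsilon> = - 1" "0 < d $ k"
  shows "rho d B k \<epsilon> x = x + ham_speed d B k \<epsilon> x *\<^sub>R ham_dir d B k"
  unfolding rho_def time_one_flow_def
proof (rule the1_equality[OF time_one_flow_ex1[OF assms]])
  show "\<exists>\<gamma>. hamilton_solution (hamiltonian d B k \<epsilon>) {0..1} \<gamma> \<and> \<gamma> 0 = x
      \<and> \<gamma> 1 = x + ham_speed d B k \<epsilon> x *\<^sub>R ham_dir d B k"
    by (rule exI[of _ "\<lambda>t. x + (t * ham_speed d B k \<epsilon> x) *\<^sub>R ham_dir d B k"])
      (simp add: hamilton_solution_iff[OF assms])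
qed

lemma bounded_linear_tau: "bounded_linear (tau B k \<epsilon> :: 'n::finite phase \<Rightarrow> _)"
proof -
  have "linear (tau B k \<epsilon> :: 'n phase \<Rightarrow> _)"
    by (rule linearI)
      (auto simp: tau_def vec_eq_iff algebra_simps sum.distrib sum_distrib_left intro!: prod_eqI)
  then show ?thesis by (rule linear_conv_bounded_linear[THEN iffD1])
qed

text \<open>
  Along a step \<open>u\<^sub>k\<close> moves with constant velocity \<open>- ham_speed\<close>, while \<open>p\<^sub>k\<close> and the Hamiltonian do
  not change; so this is the constant value of the Lagrangian, and the integral over a unit of
  time.
\<close>
definition step_action :: "'n int_vec \<Rightarrow> 'n int_mat \<Rightarrow> 'n \<Rightarrow> int \<Rightarrow> 'n::finite phase \<Rightarrow> real" where
  "step_action d B k \<epsilon> x = - (ham_speed d B k \<epsilon> x * snd x $ k) - hamiltonian d B k \<epsilon> x"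

definition total_action ::
  "'n int_vec \<Rightarrow> 'n int_mat \<Rightarrow> (nat \<Rightarrow> 'n) \<Rightarrow> (nat \<Rightarrow> int) \<Rightarrow> nat \<Rightarrow> 'n::finite phase \<Rightarrow> real" where
  "total_action d B k \<epsilon> T x =
     (\<Sum>s<T. step_action d (B_seq B k s) (k s) (\<epsilon> s) (phase_seq d B k \<epsilon> x s))"

text \<open>
  \<open>p\<^sub>k\<close> is conserved because its velocity is proportional to the diagonal entry \<open>b\<^sub>k\<^sub>k\<close>, which
  vanishes by skew-symmetrizability.
\<close>
lemma integral_lagrangian:
  assumes sk: "skew_symmetrizer d (B_seq B k s)" and sg: "\<epsilon> s = 1 \<or> \<epsilon> s = - 1"
    and sol: "hamilton_solution (hamiltonian d (B_seq B k s) (k s) (\<epsilon> s)) {real s..real (Suc s)} (\<gamma> s)"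
  shows "integral {real s..real (Suc s)} (lagrangian d B k \<epsilon> \<gamma> s)
      = step_action d (B_seq B k s) (k s) (\<epsilon> s) (\<gamma> s (real s))"
proof -
  define X where "X = \<gamma> s (real s)"
  let ?dir = "ham_dir d (B_seq B k s) (k s)"
  let ?v = "ham_speed d (B_seq B k s) (k s) (\<epsilon> s) X"
  note pos = skew_symmetrizer_pos[OF sk, of "k s"]
  have le: "real s \<le> real (Suc s)"
    by simp
  have \<gamma>: "\<gamma> s t = X + ((t - s) * ?v) *\<^sub>R ?dir" if "t \<in> {real s..real (Suc s)}" for t
    using sol[unfolded hamilton_solution_iff[OF sg pos le]] that unfolding X_def by blast
  have "lagrangian d B k \<epsilon> \<gamma> s t = step_action d (B_seq B k s) (k s) (\<epsilon> s) X"
    if t: "t \<in> {real s..real (Suc s)}" for t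
  proof -
    have "((\<lambda>r. fst X $ k s - (r - s) * ?v) has_vector_derivative - ?v)
        (at t within {real s..real (Suc s)})"
      by (auto intro!: derivative_eq_intros)
    then have "((\<lambda>r. fst (\<gamma> s r) $ k s) has_vector_derivative - ?v)
        (at t within {real s..real (Suc s)})"
      by (rule has_vector_derivative_transform[OF t, rotated])
        (simp add: \<gamma> ham_dir_def axis_def)
    then have "vector_derivative (\<lambda>r. fst (\<gamma> s r) $ k s) (at t within {real s..real (Suc s)}) = - ?v"
      using t by (intro vector_derivative_within_closed_interval) auto
    then show ?thesis
      using \<gamma>[OF t] hamiltonian_const[of "\<epsilon> s" d "k s", OF sg pos]
      by (simp add: lagrangian_def step_action_def ham_dir_def skew_symmetrizer_diag[OF sk])
  qed
  then have "integral {real s..real (Suc s)} (lagrangian d B k \<epsilon> \<gamma> s)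
      = integral {real s..real (Suc s)} (\<lambda>t. step_action d (B_seq B k s) (k s) (\<epsilon> s) X)"
    by (intro integral_cong) auto
  then show ?thesis by (simp add: X_def)
qed

lemma action_integral_eq_total_action:
  assumes sk: "skew_symmetrizer d B" and sg: "\<And>s. s < T \<Longrightarrow> \<epsilon> s = 1 \<or> \<epsilon> s = - 1"
    and flow: "hamiltonian_flow d B k \<epsilon> T x \<gamma>"
  shows "action_integral d B k \<epsilon> T \<gamma> = total_action d B k \<epsilon> T (x 0)"
proof -
  note skB = skew_symmetrizer_B_seq[OF sk]
  have x: "x s = phase_seq d B k \<epsilon> (x 0) s" if "s \<le> T" for s
    using that
  proof (induction s)
    case 0
    then show ?case by simp
  next
    case (Suc s)
    let ?B = "B_seq B k s"
    note pos = skew_symmetrizer_pos[OF skB[of k s], of "k s"]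
    have s: "hamilton_solution (hamiltonian d ?B (k s) (\<epsilon> s)) {real s..real (Suc s)} (\<gamma> s)"
      "\<gamma> s (real s) = x s" "x (Suc s) = tau ?B (k s) (\<epsilon> s) (\<gamma> s (real (Suc s)))"
      using flow Suc.prems by (auto simp: hamiltonian_flow_def)
    have "\<gamma> s (real (Suc s)) = x s + ham_speed d ?B (k s) (\<epsilon> s) (x s) *\<^sub>R ham_dir d ?B (k s)"
      using s hamilton_solution_iff[OF sg pos, of s "real s" "real (Suc s)"] Suc.prems by auto
    then show ?case
      using Suc s sg[of s] pos by (simp add: signed_mutation_def rho_eq)
  qed
  have "integral {real s..real (Suc s)} (lagrangian d B k \<epsilon> \<gamma> s)
      = step_action d (B_seq B k s) (k s) (\<epsilon> s) (phase_seq d B k \<epsilon> (x 0) s)" if "s < T" for s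
    using integral_lagrangian[where k = k and \<epsilon> = \<epsilon> and \<gamma> = \<gamma>, OF skB sg[OF that]] flow x[of s] that
    by (simp add: hamiltonian_flow_def)
  then show ?thesis
    by (simp add: action_integral_def total_action_def)
qed


section \<open>The action as the variation of the Liouville form\<close>

text \<open>
  A tangent vector \<open>v\<close> at \<open>x\<close> is paired with the Liouville form to \<open>snd x \<bullet> fst v\<close>.  The map \<open>tau\<close>
  is a linear change of the \<open>u\<close> coordinates together with the dual change of the \<open>p\<close> coordinates,
  so the pairing is invariant: the multiples of \<open>p\<^sub>k\<close> added to the other \<open>p\<^sub>i\<close> cancel against the
  multiples of \<open>u\<^sub>i\<close> added to \<open>u\<^sub>k\<close>.
\<close>
lemma liouville_tau:
  assumes "B $ k $ k = 0"
  shows "snd (tau B k \<epsilon> x) \<bullet> fst (tau B k \<epsilon> v) = snd x \<bullet> fst (v :: 'n::finite phase)"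
proof -
  define a where "a j = (of_int (pos_part (- (\<epsilon> * B $ j $ k))) :: real)" for j
  have a: "a k = 0"
    using assms by (simp add: a_def pos_part_def)
  have "snd (tau B k \<epsilon> x) \<bullet> fst (tau B k \<epsilon> v)
      = - snd x $ k * (- fst v $ k + (\<Sum>j\<in>UNIV. a j * fst v $ j))
        + (\<Sum>i\<in>UNIV - {k}. (snd x $ i + a i * snd x $ k) * fst v $ i)"
    by (simp add: inner_vec_def sum.remove[of UNIV k] tau_def a_def)
  also have "\<dots> = snd x $ k * fst v $ k + (\<Sum>i\<in>UNIV - {k}. snd x $ i * fst v $ i)"
    by (simp add: sum.remove[of UNIV k] a algebra_simps sum.distrib sum_distrib_left sum_negf)
  also have "\<dots> = snd x \<bullet> fst v"
    by (simp add: inner_vec_def sum.remove[of UNIV k])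
  finally show ?thesis .
qed

text \<open>
  The first variation formula for one step, with the Liouville form and the differential of the
  action evaluated on the velocity of a curve \<open>c\<close> of initial points.  Write \<open>v\<close> for the speed and
  \<open>(- e\<^sub>k, q)\<close> for \<open>ham_dir\<close>.  Hamilton's equations turn the derivative of \<open>H\<close> along \<open>c\<close> into
  \<open>- v * (p\<^sub>k' + q \<bullet> u')\<close>, so the derivative of the action \<open>- v * p\<^sub>k - H\<close> is \<open>- v' * p\<^sub>k + v * (q \<bullet> u')\<close>.
  The change of the pairing, \<open>(p + v q) \<bullet> (u' - v' e\<^sub>k) - p \<bullet> u'\<close>, is the same because \<open>q\<^sub>k = 0\<close>.
\<close>
lemma liouville_rho:
  assumes sk: "skew_symmetrizer d B" and sg: "\<epsilon> = 1 \<or> \<epsilon> = - 1"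
    and c: "(c has_vector_derivative c') (at r)"
  obtains D where "((\<lambda>r. rho d B k \<epsilon> (c r)) has_vector_derivative D) (at r)"
    and "((\<lambda>r. step_action d B k \<epsilon> (c r)) has_real_derivative
           snd (rho d B k \<epsilon> (c r)) \<bullet> fst D - snd (c r) \<bullet> fst c') (at r)"
proof -
  have pos: "0 < d $ k"
    using sk by (rule skew_symmetrizer_pos)
  define L where "L r = log_y d B k (c r)" for r
  define L' where "L' = log_y d B k c'"
  define v where "v r = ham_speed d B k \<epsilon> (c r)" for r
  define E where "E = exp (of_int \<epsilon> * L r)"
  define v' where "v' = 1 / (1 + E) * (E * (of_int \<epsilon> * L')) / 2"
  have Epos: "E > 0" by (simp add: E_def)
  have ee: "of_int \<epsilon> * of_int \<epsilon> = (1::real)"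
    using sg by auto
  have L: "(L has_real_derivative L') (at r)"
    using bounded_linear.has_vector_derivative[OF bounded_linear_log_y c, of d B k]
    unfolding has_real_derivative_iff_has_vector_derivative L_def[abs_def] L'_def .
  have v_eq: "v = (\<lambda>r. ln (1 + exp (of_int \<epsilon> * L r)) / 2)"
    by (simp add: v_def L_def fun_eq_iff ham_speed_eq_log_y[OF sg])
  have v: "(v has_real_derivative v') (at r)"
    unfolding v_eq v'_def using Epos
    by (intro DERIV_cdivide DERIV_chain2[OF DERIV_ln_divide])
      (auto simp: E_def add_pos_pos intro!: derivative_eq_intros L)
  have "(Li2 has_real_derivative - ln (1 - (- E)) / (- E)) (at (- E))"
    using Epos by (intro Li2_has_real_derivative) simp
  then have "((\<lambda>r. Li2 (- exp (of_int \<epsilon> * L r))) has_real_derivative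
      - ln (1 - (- E)) / (- E) * - (E * (of_int \<epsilon> * L'))) (at r)"
    by (intro DERIV_chain2[of Li2]) (auto simp: E_def intro!: derivative_eq_intros L)
  then have "((\<lambda>r. hamiltonian d B k \<epsilon> (c r)) has_real_derivative
      of_int \<epsilon> / (2 * of_int (d $ k)) * (- ln (1 - (- E)) / (- E) * - (E * (of_int \<epsilon> * L')))) (at r)"
    unfolding hamiltonian_eq_log_y[OF sg] L_def by (intro DERIV_cmult)
  also have "of_int \<epsilon> / (2 * of_int (d $ k)) * (- ln (1 - (- E)) / (- E) * - (E * (of_int \<epsilon> * L')))
      = - ((of_int \<epsilon> * of_int \<epsilon>) * L' * ln (1 + E) / (2 * of_int (d $ k)))"
    using Epos by simp
  also have "\<dots> = - v r * L' / of_int (d $ k)"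
    unfolding ee by (simp add: v_eq E_def)
  finally have H: "((\<lambda>r. hamiltonian d B k \<epsilon> (c r)) has_real_derivative
      - v r * L' / of_int (d $ k)) (at r)" .
  have pk: "((\<lambda>r. snd (c r) $ k) has_real_derivative snd c' $ k) (at r)"
    using bounded_linear.has_vector_derivative[OF
        bounded_linear_compose[OF bounded_linear_vec_nth bounded_linear_snd] c, of k]
    by (simp add: has_real_derivative_iff_has_vector_derivative)
  define D where "D = c' + v' *\<^sub>R ham_dir d B k"
  define q :: "real ^ 'a" where "q = (\<chi> i. of_int (B $ i $ k) / of_int (d $ k))"
  have q: "q $ k = 0"
    by (simp add: q_def skew_symmetrizer_diag[OF sk])
  have L'_eq: "L' / of_int (d $ k) = snd c' $ k + q \<bullet> fst c'"
    using pos by (simp add: L'_def log_y_def w_coord_def inner_vec_def q_def add_divide_distrib sum_divide_distrib)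
  show thesis
  proof (rule that)
    show "((\<lambda>r. rho d B k \<epsilon> (c r)) has_vector_derivative D) (at r)"
      unfolding rho_eq[OF sg pos] D_def v_def[symmetric]
      using v by (auto intro!: derivative_eq_intros c simp: has_real_derivative_iff_has_vector_derivative)
    have "((\<lambda>r. step_action d B k \<epsilon> (c r)) has_real_derivative
        - (v' * snd (c r) $ k + v r * snd c' $ k) - (- v r * L' / of_int (d $ k))) (at r)"
      unfolding step_action_def v_def[symmetric]
      by (auto intro!: derivative_eq_intros H v pk)
    also have "- (v' * snd (c r) $ k + v r * snd c' $ k) - (- v r * L' / of_int (d $ k))
        = - v' * snd (c r) $ k + v r * (q \<bullet> fst c')"
      using arg_cong[OF L'_eq, of "\<lambda>z. v r * z"] by (simp add: algebra_simps)
    also have "\<dots> = snd (rho d B k \<epsilon> (c r)) \<bullet> fst D - snd (c r) \<bullet> fst c'"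
    proof -
      have "ham_dir d B k = (- axis k 1, q)"
        by (simp add: ham_dir_def q_def axis_def vec_eq_iff)
      then show ?thesis
        using q unfolding rho_eq[OF sg pos] D_def v_def[symmetric]
        by (simp add: inner_add_left inner_add_right inner_axis algebra_simps)
    qed
    finally show "((\<lambda>r. step_action d B k \<epsilon> (c r)) has_real_derivative
        snd (rho d B k \<epsilon> (c r)) \<bullet> fst D - snd (c r) \<bullet> fst c') (at r)" .
  qed
qed

lemma liouville_phase_seq:
  assumes sk: "skew_symmetrizer d B" and sg: "\<And>s. s < T \<Longrightarrow> \<epsilon> s = 1 \<or> \<epsilon> s = - 1"
    and c: "(c has_vector_derivative c') (at r)"
  shows "\<exists>D. ((\<lambda>r. phase_seq d B k \<epsilon> (c r) T) has_vector_derivative D) (at r) \<and>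
     ((\<lambda>r. total_action d B k \<epsilon> T (c r)) has_real_derivative
        snd (phase_seq d B k \<epsilon> (c r) T) \<bullet> fst D - snd (c r) \<bullet> fst c') (at r)"
  using sg
proof (induction T)
  case 0
  show ?case
    using c by (intro exI[of _ c']) (simp add: total_action_def)
next
  case (Suc T)
  let ?B = "B_seq B k T" and ?\<epsilon> = "\<epsilon> T" and ?k = "k T"
  obtain D where D: "((\<lambda>r. phase_seq d B k \<epsilon> (c r) T) has_vector_derivative D) (at r)"
    "((\<lambda>r. total_action d B k \<epsilon> T (c r)) has_real_derivative
        snd (phase_seq d B k \<epsilon> (c r) T) \<bullet> fst D - snd (c r) \<bullet> fst c') (at r)"
    using Suc by auto
  note skT = skew_symmetrizer_B_seq[OF sk, of k T]
  obtain D' where D':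
    "((\<lambda>r. rho d ?B ?k ?\<epsilon> (phase_seq d B k \<epsilon> (c r) T)) has_vector_derivative D') (at r)"
    "((\<lambda>r. step_action d ?B ?k ?\<epsilon> (phase_seq d B k \<epsilon> (c r) T)) has_real_derivative
       snd (rho d ?B ?k ?\<epsilon> (phase_seq d B k \<epsilon> (c r) T)) \<bullet> fst D'
         - snd (phase_seq d B k \<epsilon> (c r) T) \<bullet> fst D) (at r)"
    by (rule liouville_rho[OF skT _ D(1), of ?\<epsilon> ?k]) (use Suc.prems in auto)
  let ?\<tau> = "tau ?B ?k ?\<epsilon>"
  have "((\<lambda>r. phase_seq d B k \<epsilon> (c r) (Suc T)) has_vector_derivative ?\<tau> D') (at r)"
    using bounded_linear.has_vector_derivative[OF bounded_linear_tau D'(1)]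
    by (simp add: signed_mutation_def)
  moreover have "((\<lambda>r. total_action d B k \<epsilon> (Suc T) (c r)) has_real_derivative
        snd (phase_seq d B k \<epsilon> (c r) (Suc T)) \<bullet> fst (?\<tau> D') - snd (c r) \<bullet> fst c') (at r)"
    using DERIV_add[OF D(2) D'(2)]
    by (simp add: total_action_def signed_mutation_def liouville_tau skew_symmetrizer_diag[OF skT])
  ultimately show ?case by blast
qed

text \<open>
  The first variation vanishes along the segment from \<open>x\<close> to \<open>y\<close>, because the composite of all
  steps permutes the canonical pairs \<open>(u\<^sub>i, p\<^sub>i)\<close>.
\<close>
lemma total_action_const:
  assumes sk: "skew_symmetrizer d B" and sg: "\<And>s. s < T \<Longrightarrow> \<epsilon> s = 1 \<or> \<epsilon> s = - 1"
    and \<sigma>: "\<sigma> permutes UNIV" and per: "sigma_periodic d B k \<epsilon> T \<sigma>"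
  shows "total_action d B k \<epsilon> T x = total_action d B k \<epsilon> T y"
proof -
  define P :: "'a phase \<Rightarrow> 'a phase" where "P z = (\<chi> i. fst z $ \<sigma> i, \<chi> i. snd z $ \<sigma> i)" for z
  have end_point: "phase_seq d B k \<epsilon> z T = P z" for z
  proof -
    have "fst (phase_seq d B k \<epsilon> z T) $ inv \<sigma> (\<sigma> i) = fst z $ \<sigma> i \<and>
        snd (phase_seq d B k \<epsilon> z T) $ inv \<sigma> (\<sigma> i) = snd z $ \<sigma> i" for i
      using per unfolding sigma_periodic_def by blast
    then show ?thesis
      using permutes_inverses(2)[OF \<sigma>] by (auto simp: P_def vec_eq_iff intro!: prod_eqI)
  qed
  have "linear P"
    by (rule linearI) (auto simp: P_def vec_eq_iff intro!: prod_eqI)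
  then have P: "bounded_linear P"
    by (rule linear_conv_bounded_linear[THEN iffD1])
  have P_inner: "snd (P z) \<bullet> fst (P w) = snd z \<bullet> fst w" for z w
    using sum.permute[OF \<sigma>, of "\<lambda>i. snd z $ i * fst w $ i"]
    by (simp add: P_def inner_vec_def o_def)
  define c where "c r = x + r *\<^sub>R (y - x)" for r :: real
  have c: "(c has_vector_derivative (y - x)) (at r)" for r
    unfolding c_def by (auto intro!: derivative_eq_intros)
  have "((\<lambda>r. total_action d B k \<epsilon> T (c r)) has_real_derivative 0) (at r)" for r
  proof -
    have "\<exists>D. ((\<lambda>r. phase_seq d B k \<epsilon> (c r) T) has_vector_derivative D) (at r) \<and>
     ((\<lambda>r. total_action d B k \<epsilon> T (c r)) has_real_derivative
        snd (phase_seq d B k \<epsilon> (c r) T) \<bullet> fst D - snd (c r) \<bullet> fst (y - x)) (at r)"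
      by (rule liouville_phase_seq[OF sk sg c])
    then obtain D where D: "((\<lambda>r. P (c r)) has_vector_derivative D) (at r)"
     "((\<lambda>r. total_action d B k \<epsilon> T (c r)) has_real_derivative
        snd (P (c r)) \<bullet> fst D - snd (c r) \<bullet> fst (y - x)) (at r)"
      unfolding end_point by blast
    have "D = P (y - x)"
      using D(1) bounded_linear.has_vector_derivative[OF P c] by (rule vector_derivative_unique_at)
    then show ?thesis
      using D(2) P_inner by simp
  qed
  then have "total_action d B k \<epsilon> T (c 0) = total_action d B k \<epsilon> T (c 1)"
    using DERIV_isconst_all by blast
  then show ?thesis
    by (simp add: c_def)
qed


section \<open>Tropical exponents\<close>

lemma pi_trop_spec: "trop_hom pi_trop" "pi_trop (y_var i) = axis i 1"
  unfolding pi_trop_def using theI'[OF trop_hom_ex1] by blast+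

lemma pi_trop_mult: "f \<in> subfree \<Longrightarrow> g \<in> subfree \<Longrightarrow> pi_trop (f * g) = pi_trop f + pi_trop g"
  using pi_trop_spec(1) by (auto simp: trop_hom_def)

lemma pi_trop_add:
  "f \<in> subfree \<Longrightarrow> g \<in> subfree \<Longrightarrow> pi_trop (f + g) = (\<chi> i. min (pi_trop f $ i) (pi_trop g $ i))"
  using pi_trop_spec(1) by (auto simp: trop_hom_def)

lemma pi_trop_1: "pi_trop 1 = 0"
  using pi_trop_mult[OF subfree_1 subfree_1] by simp

lemma pi_trop_inverse: "f \<in> subfree \<Longrightarrow> pi_trop (inverse f) = - pi_trop f"
proof -
  assume f: "f \<in> subfree"
  have "pi_trop f + pi_trop (inverse f) = pi_trop (f * inverse f)"
    using f by (simp only: pi_trop_mult subfree_closed(3))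
  also have "\<dots> = 0"
    using subfree_closed(4)[OF f f] by (simp add: pi_trop_1)
  finally show ?thesis
    by (simp add: eq_neg_iff_add_eq_0 add.commute)
qed

lemma pi_trop_powi: "f \<in> subfree \<Longrightarrow> pi_trop (f powi m) $ i = m * pi_trop f $ i"
proof -
  assume f: "f \<in> subfree"
  have *: "pi_trop (g ^ l) $ i = int l * pi_trop g $ i" if "g \<in> subfree" for g :: "'a rat_fun" and l
  proof (induction l)
    case (Suc l)
    have "g ^ l \<in> subfree"
      using subfree_powi[OF that, of "int l"] by simp
    then show ?case
      using Suc that by (simp add: pi_trop_mult algebra_simps)
  qed (simp add: pi_trop_1)
  show ?thesis
    using f by (simp add: power_int_def * subfree_closed(3) pi_trop_inverse)
qed

text \<open>
  With the tropical sign \<open>\<epsilon>\<close> all exponents of \<open>y\<^sub>k powi \<epsilon>\<close> are nonnegative, so the tropical value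
  of \<open>1 + y\<^sub>k powi \<epsilon>\<close> is trivial.  This is why the mutation formula must be used with this sign:
  only the monomial factors then survive, and the exponents mutate piecewise linearly.
\<close>
lemma pi_trop_y_seq_Suc:
  assumes "is_tropical_sign B k s \<epsilon>"
  shows "pi_trop (y_seq B k (Suc s) i) $ j =
     (if i = k s then - pi_trop (y_seq B k s (k s)) $ j
      else pi_trop (y_seq B k s i) $ j
        + pos_part (\<epsilon> * B_seq B k s $ k s $ i) * pi_trop (y_seq B k s (k s)) $ j)"
proof -
  let ?y = "y_seq B k s" and ?b = "B_seq B k s $ k s $ i"
  note y = y_seq_subfree[of B k s]
  have eq: "y_seq B k (Suc s) = y_mutation \<epsilon> (B_seq B k s) (k s) ?y"
    using y_mutation_sign_independent[OF subfree_closed(4)[OF y y], of "B_seq B k s" "k s"] assms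
    by (auto simp: is_tropical_sign_def Let_def)
  have "pi_trop (1 + ?y (k s) powi \<epsilon>) = 0"
    using assms y
    by (auto simp: pi_trop_add subfree_1 subfree_powi pi_trop_1 pi_trop_powi vec_eq_iff
        is_tropical_sign_def Let_def)
  then show ?thesis
    using y unfolding eq
    by (simp add: y_mutation_def pi_trop_inverse pi_trop_mult pi_trop_powi subfree_closed subfree_powi subfree_1)
qed

text \<open>
  The map \<open>tau\<close> realises on the logarithms of the \<open>y\<close>-variables the same recursion that the
  tropical exponents satisfy; the binomial factors of the \<open>y\<close>-mutation come from \<open>rho\<close> alone.
\<close>
lemma log_y_tau:
  assumes sk: "skew_symmetrizer d B" and sg: "\<epsilon> = 1 \<or> \<epsilon> = - 1"
  shows "log_y d (matrix_mutation 1 k B) i (tau B k \<epsilon> x) =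
    (if i = k then - log_y d B k x else log_y d B i x + of_int (pos_part (\<epsilon> * B $ k $ i)) * log_y d B k x)"
proof -
  \<comment> \<open>With the sign of \<open>tau\<close>, the terms in \<open>pos_part (- \<epsilon> * b\<^sub>j\<^sub>k)\<close> from \<open>tau\<close> and from the matrix cancel.\<close>
  have B': "matrix_mutation 1 k B = matrix_mutation \<epsilon> k B"
    using sg matrix_mutation_sign_independent[of k B] by auto
  note diag = skew_symmetrizer_diag[OF sk]
  define a where "a j = (of_int (pos_part (- (\<epsilon> * B $ j $ k))) :: real)" for j
  define b where "b j i = (of_int (B $ j $ i) :: real)" for i j
  define u where "u = fst x"
  have a: "a k = 0" "b k k = 0"
    by (simp_all add: a_def b_def diag pos_part_def)
  show ?thesis
  proof (cases "i = k")
    case True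
    have "w_coord (matrix_mutation \<epsilon> k B) (tau B k \<epsilon> x) k = - w_coord B x k"
      by (simp add: w_coord_def matrix_mutation_def tau_def diag sum.remove[of UNIV k] sum_negf)
    then show ?thesis
      using True by (simp add: B' log_y_def tau_def)
  next
    case False
    define m where "m = (of_int (pos_part (\<epsilon> * B $ k $ i)) :: real)"
    have "w_coord (matrix_mutation \<epsilon> k B) (tau B k \<epsilon> x) i
       = - b k i * (- u $ k + (\<Sum>j\<in>UNIV. a j * u $ j))
         + (\<Sum>j\<in>UNIV - {k}. (b j i + a j * b k i + b j k * m) * u $ j)"
      using False
      by (simp add: w_coord_def sum.remove[of UNIV k] matrix_mutation_def tau_def a_def b_def m_def u_def)
    also have "\<dots> = w_coord B x i + m * w_coord B x k"
      unfolding w_coord_def b_def[symmetric] u_def[symmetric]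
      by (simp add: sum.remove[of UNIV k] a algebra_simps sum.distrib sum_distrib_left sum_negf)
    finally have w: "w_coord (matrix_mutation \<epsilon> k B) (tau B k \<epsilon> x) i = w_coord B x i + m * w_coord B x k" .
    have "real_of_int (d $ i) * a i = of_int (d $ k) * m"
      using skew_symmetrizer_pos_part_swap[OF sk, of i \<epsilon> k]
      unfolding a_def m_def by (metis of_int_mult)
    then have "real_of_int (d $ i) * (a i * snd x $ k) = m * (of_int (d $ k) * snd x $ k)"
      by (simp add: mult.assoc[symmetric])
    then show ?thesis
      using False w by (simp add: B' log_y_def tau_def algebra_simps flip: a_def m_def)
  qed
qed

text \<open>The orbit with the nonlinear factors \<open>rho\<close> left out: the leading term of the flow far from the origin.\<close>
primrec trop_seq ::
    "'n int_mat \<Rightarrow> (nat \<Rightarrow> 'n) \<Rightarrow> (nat \<Rightarrow> int) \<Rightarrow> 'n::finite phase \<Rightarrow> nat \<Rightarrow> 'n phase" where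
  "trop_seq B k \<epsilon> x 0 = x"
| "trop_seq B k \<epsilon> x (Suc s) = tau (B_seq B k s) (k s) (\<epsilon> s) (trop_seq B k \<epsilon> x s)"

text \<open>The point where every \<open>y\<close>-variable has logarithm \<open>- 1\<close>.\<close>
definition trop_start :: "'n int_vec \<Rightarrow> 'n::finite phase" where
  "trop_start d = (0, \<chi> i. - 1 / of_int (d $ i))"

lemma log_y_trop_seq:
  fixes B :: "'n::{finite,linorder} int_mat"
  assumes sk: "skew_symmetrizer d B" and ts: "tropical_sign_sequence B k T \<epsilon>" and "s \<le> T"
  shows "log_y d (B_seq B k s) i (trop_seq B k \<epsilon> (trop_start d) s)
    = - of_int (\<Sum>j\<in>UNIV. pi_trop (y_seq B k s i) $ j)"
  using \<open>s \<le> T\<close>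
proof (induction s arbitrary: i)
  case 0
  then show ?case
    using skew_symmetrizer_pos[OF sk, of i]
    by (simp add: log_y_def w_coord_def trop_start_def pi_trop_spec axis_def)
next
  case (Suc s)
  then have t: "is_tropical_sign B k s (\<epsilon> s)"
    using ts by (simp add: tropical_sign_sequence_def)
  then have sg: "\<epsilon> s = 1 \<or> \<epsilon> s = - 1"
    by (auto simp: is_tropical_sign_def Let_def)
  show ?case
    using log_y_tau[where k = "k s" and i = i, OF skew_symmetrizer_B_seq[OF sk] sg] Suc
    unfolding pi_trop_y_seq_Suc[OF t]
    by (simp add: sum.distrib sum_negf sum_distrib_left)
qed

text \<open>
  The bound \<open>- 1\<close> is the largest negative integer: the left side is minus the sum of the exponents
  of \<open>y\<^sub>k powi \<epsilon>\<close>, which are nonnegative integers, not all zero.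
\<close>
lemma trop_seq_sign:
  fixes B :: "'n::{finite,linorder} int_mat"
  assumes sk: "skew_symmetrizer d B" and ts: "tropical_sign_sequence B k T \<epsilon>" and "s < T"
  shows "of_int (\<epsilon> s) * log_y d (B_seq B k s) (k s) (trop_seq B k \<epsilon> (trop_start d) s) \<le> - 1"
proof -
  define c where "c = pi_trop (y_seq B k s (k s))"
  have t: "c \<noteq> 0" "\<epsilon> s = 1 \<and> (\<forall>i. 0 \<le> c $ i) \<or> \<epsilon> s = - 1 \<and> (\<forall>i. c $ i \<le> 0)"
    using ts \<open>s < T\<close> by (auto simp: tropical_sign_sequence_def is_tropical_sign_def Let_def c_def)
  obtain i where i: "c $ i \<noteq> 0"
    using t(1) by (auto simp: vec_eq_iff)
  have nn: "0 \<le> \<epsilon> s * c $ j" for j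
    using t(2) by auto
  have "1 \<le> \<epsilon> s * c $ i"
    using nn[of i] i t(2) by force
  also have "\<dots> \<le> (\<Sum>j\<in>UNIV. \<epsilon> s * c $ j)"
    using nn by (intro member_le_sum) auto
  finally have "1 \<le> \<epsilon> s * (\<Sum>j\<in>UNIV. c $ j)"
    by (simp add: sum_distrib_left)
  then have "(1::real) \<le> of_int (\<epsilon> s * (\<Sum>j\<in>UNIV. c $ j))"
    by linarith
  then show ?thesis
    using log_y_trop_seq[OF sk ts, of s "k s"] \<open>s < T\<close> by (simp add: c_def)
qed


section \<open>Vanishing of the action in the tropical limit\<close>

text \<open>The integrand of the dilogarithm lies between \<open>0\<close> and \<open>1\<close>.\<close>
lemma Li2_bound:
  assumes "0 \<le> y"
  shows "\<bar>Li2 (- y)\<bar> \<le> y"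
proof (cases "(\<lambda>z. ln (1 + z) / z) integrable_on {0..y}")
  case True
  have "\<bar>ln (1 + z) / z\<bar> \<le> 1" if "z \<in> {0..y}" for z :: real
    using that ln_add_one_self_le_self[of z] by (cases "z = 0") (auto simp: divide_le_eq)
  then have "norm (integral {0..y} (\<lambda>z. ln (1 + z) / z)) \<le> 1 * measure lborel (cbox 0 y)"
    using True by (intro has_integral_bound[where f = "\<lambda>z. ln (1 + z) / z"]) (auto intro: integrable_integral)
  then show ?thesis
    using assms by (simp add: Li2_def)
qed (use assms in \<open>simp add: Li2_def not_integrable_integral\<close>)

lemma ham_speed_bound:
  assumes "\<epsilon> = 1 \<or> \<epsilon> = - 1"
  shows "0 \<le> ham_speed d B k \<epsilon> x" "ham_speed d B k \<epsilon> x \<le> exp (of_int \<epsilon> * log_y d B k x)"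
proof -
  let ?E = "exp (of_int \<epsilon> * log_y d B k x)"
  have "ln (1 + ?E) \<le> ?E" "0 \<le> ln (1 + ?E)" "0 \<le> ?E"
    by (auto intro: ln_add_one_self_le_self)
  then show "0 \<le> ham_speed d B k \<epsilon> x" "ham_speed d B k \<epsilon> x \<le> ?E"
    unfolding ham_speed_eq_log_y[OF assms] by linarith+
qed

lemma step_action_bound:
  assumes sg: "\<epsilon> = 1 \<or> \<epsilon> = - 1" and pos: "0 < d $ k"
  shows "\<bar>step_action d B k \<epsilon> x\<bar> \<le> exp (of_int \<epsilon> * log_y d B k x) * (norm x + 1)"
proof -
  let ?E = "exp (of_int \<epsilon> * log_y d B k x)"
  have "\<bar>snd x $ k\<bar> \<le> norm x"
    using component_le_norm_cart[of "snd x" k] norm_snd_le[of "snd x" "fst x"] by simp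
  then have 1: "\<bar>ham_speed d B k \<epsilon> x * snd x $ k\<bar> \<le> ?E * norm x"
    unfolding abs_mult using ham_speed_bound[OF sg, of d B k x] by (intro mult_mono) auto
  have "\<bar>of_int \<epsilon> / (2 * of_int (d $ k)) :: real\<bar> \<le> 1"
    using sg pos by (auto simp: abs_mult)
  then have "\<bar>hamiltonian d B k \<epsilon> x\<bar> \<le> 1 * ?E"
    unfolding hamiltonian_eq_log_y[OF sg] abs_mult by (intro mult_mono Li2_bound) auto
  then show ?thesis
    using 1 by (simp add: step_action_def algebra_simps)
qed

text \<open>
  A bounded displacement from the ray through \<open>z\<close> changes the linear functional \<open>log_y\<close> by a
  bounded amount only, and so costs a constant factor after exponentiation.
\<close>
lemma exp_log_y_decay:
  assumes m: "of_int \<epsilon> * log_y d B k z \<le> - 1" and sg: "\<epsilon> = 1 \<or> \<epsilon> = - 1"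
  shows "\<exists>K. \<forall>r x. 0 \<le> r \<longrightarrow> norm (x - r *\<^sub>R z) \<le> C \<longrightarrow>
    exp (of_int \<epsilon> * log_y d B k x) \<le> K * exp (- r)"
proof -
  obtain M where M: "M > 0" "\<And>x. norm (log_y d B k x) \<le> norm x * M"
    using bounded_linear.pos_bounded[OF bounded_linear_log_y] by blast
  show ?thesis
  proof (intro exI[of _ "exp (C * M)"] allI impI)
    fix r x assume h: "0 \<le> r" "norm (x - r *\<^sub>R z) \<le> C"
    have "log_y d B k x = r * log_y d B k z + log_y d B k (x - r *\<^sub>R z)"
      by (simp add: linear_simps[OF bounded_linear_log_y])
    then have "of_int \<epsilon> * log_y d B k x
        = r * (of_int \<epsilon> * log_y d B k z) + of_int \<epsilon> * log_y d B k (x - r *\<^sub>R z)"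
      by (simp add: algebra_simps)
    also have "r * (of_int \<epsilon> * log_y d B k z) \<le> - r"
      using mult_left_mono[OF m h(1)] by simp
    also have "of_int \<epsilon> * log_y d B k (x - r *\<^sub>R z) \<le> norm (log_y d B k (x - r *\<^sub>R z))"
      using sg by auto
    also have "\<dots> \<le> C * M"
      using M(2)[of "x - r *\<^sub>R z"] mult_right_mono[OF h(2), of M] M(1) by linarith
    finally show "exp (of_int \<epsilon> * log_y d B k x) \<le> exp (C * M) * exp (- r)"
      by (simp flip: exp_add)
  qed
qed

text \<open>
  Each step enlarges the error of the linear approximation by a constant factor and by a multiple
  of the speed.  The speed is bounded because the preceding error bound already forces \<open>y\<^sub>k powi \<epsilon>\<close> to decay.  With the
  opposite sign the speed would grow linearly in \<open>r\<close>.
\<close>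
lemma phase_seq_near_trop_seq:
  fixes B :: "'n::{finite,linorder} int_mat"
  assumes sk: "skew_symmetrizer d B" and ts: "tropical_sign_sequence B k T \<epsilon>"
    and sg: "\<And>s. s < T \<Longrightarrow> \<epsilon> s = 1 \<or> \<epsilon> s = - 1" and "s \<le> T"
  shows "\<exists>C. \<forall>r\<ge>0. norm (phase_seq d B k \<epsilon> (r *\<^sub>R trop_start d) s
      - r *\<^sub>R trop_seq B k \<epsilon> (trop_start d) s) \<le> C"
  using \<open>s \<le> T\<close>
proof (induction s)
  case 0
  show ?case by (intro exI[of _ 0]) simp
next
  case (Suc s)
  let ?B = "B_seq B k s" and ?k = "k s" and ?\<epsilon> = "\<epsilon> s" and ?z = "trop_seq B k \<epsilon> (trop_start d) s"
  let ?x = "\<lambda>r. phase_seq d B k \<epsilon> (r *\<^sub>R trop_start d) s"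
  let ?dir = "ham_dir d ?B ?k"
  note skB = skew_symmetrizer_B_seq[OF sk, of k s]
  have sgs: "?\<epsilon> = 1 \<or> ?\<epsilon> = - 1" and pos: "0 < d $ ?k"
    using sg[of s] Suc.prems skew_symmetrizer_pos[OF sk] by auto
  obtain C where C: "\<And>r. 0 \<le> r \<Longrightarrow> norm (?x r - r *\<^sub>R ?z) \<le> C"
    using Suc by auto
  obtain K where K: "\<And>r x. 0 \<le> r \<Longrightarrow> norm (x - r *\<^sub>R ?z) \<le> C \<Longrightarrow>
      exp (of_int ?\<epsilon> * log_y d ?B ?k x) \<le> K * exp (- r)"
    using exp_log_y_decay[OF trop_seq_sign[OF sk ts] sgs] Suc.prems Suc_le_lessD by blast
  obtain M where M: "M > 0" "\<And>x. norm (tau ?B ?k ?\<epsilon> x) \<le> norm x * M"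
    using bounded_linear.pos_bounded[OF bounded_linear_tau] by blast
  have "norm (phase_seq d B k \<epsilon> (r *\<^sub>R trop_start d) (Suc s)
      - r *\<^sub>R trop_seq B k \<epsilon> (trop_start d) (Suc s)) \<le> (C + \<bar>K\<bar> * norm ?dir) * M"
    if r: "0 \<le> r" for r
  proof -
    let ?v = "ham_speed d ?B ?k ?\<epsilon> (?x r)"
    have "?v \<le> K * exp (- r)"
      using ham_speed_bound(2)[OF sgs] K[OF r C[OF r]] by (rule order_trans)
    also have "\<dots> \<le> \<bar>K\<bar> * 1"
      using r by (intro mult_mono) auto
    finally have v: "\<bar>?v\<bar> \<le> \<bar>K\<bar>"
      using ham_speed_bound(1)[OF sgs, of d ?B ?k "?x r"] by simp
    have "phase_seq d B k \<epsilon> (r *\<^sub>R trop_start d) (Suc s) - r *\<^sub>R trop_seq B k \<epsilon> (trop_start d) (Suc s)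
        = tau ?B ?k ?\<epsilon> ((?x r - r *\<^sub>R ?z) + ?v *\<^sub>R ?dir)"
      by (simp add: signed_mutation_def rho_eq[OF sgs pos] linear_simps[OF bounded_linear_tau])
    also have "norm \<dots> \<le> norm ((?x r - r *\<^sub>R ?z) + ?v *\<^sub>R ?dir) * M"
      by (rule M)
    also have "\<dots> \<le> (C + \<bar>K\<bar> * norm ?dir) * M"
      using M(1) C[OF r] v
      by (intro mult_right_mono norm_triangle_mono) (auto intro: mult_right_mono)
    finally show ?thesis .
  qed
  then show ?case by blast
qed

text \<open>
  Each step action is at most a driving variable of size \<open>O(exp (- r))\<close> times a norm of size
  \<open>O(r)\<close>.
\<close>
lemma total_action_tendsto_0:
  fixes B :: "'n::{finite,linorder} int_mat"
  assumes sk: "skew_symmetrizer d B" and ts: "tropical_sign_sequence B k T \<epsilon>"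
    and sg: "\<And>s. s < T \<Longrightarrow> \<epsilon> s = 1 \<or> \<epsilon> s = - 1"
  shows "((\<lambda>r. total_action d B k \<epsilon> T (r *\<^sub>R trop_start d)) \<longlongrightarrow> 0) at_top"
  unfolding total_action_def
proof (rule tendsto_null_sum)
  fix s assume "s \<in> {..<T}"
  then have s: "s < T" by simp
  let ?B = "B_seq B k s" and ?k = "k s" and ?\<epsilon> = "\<epsilon> s" and ?z = "trop_seq B k \<epsilon> (trop_start d) s"
  let ?x = "\<lambda>r. phase_seq d B k \<epsilon> (r *\<^sub>R trop_start d) s"
  have pos: "0 < d $ ?k"
    using skew_symmetrizer_pos[OF sk] .
  obtain C where C: "\<And>r. 0 \<le> r \<Longrightarrow> norm (?x r - r *\<^sub>R ?z) \<le> C"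
    using phase_seq_near_trop_seq[OF sk ts sg, of s] s by auto
  obtain K where K: "\<And>r x. 0 \<le> r \<Longrightarrow> norm (x - r *\<^sub>R ?z) \<le> C \<Longrightarrow>
      exp (of_int ?\<epsilon> * log_y d ?B ?k x) \<le> K * exp (- r)"
    using exp_log_y_decay[OF trop_seq_sign[OF sk ts s] sg[OF s]] by blast
  define N where "N = norm ?z"
  have "norm (step_action d ?B ?k ?\<epsilon> (?x r)) \<le> K * exp (- r) * (r * N + C + 1)" if r: "0 \<le> r" for r
  proof -
    have "norm (?x r) \<le> norm (r *\<^sub>R ?z) + C"
      using C[OF r] norm_triangle_ineq2[of "?x r" "r *\<^sub>R ?z"] by linarith
    then have "norm (?x r) + 1 \<le> r * N + C + 1"
      using r by (simp add: N_def)
    moreover have E: "exp (of_int ?\<epsilon> * log_y d ?B ?k (?x r)) \<le> K * exp (- r)"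
      using K[OF r C[OF r]] .
    ultimately have "exp (of_int ?\<epsilon> * log_y d ?B ?k (?x r)) * (norm (?x r) + 1)
        \<le> K * exp (- r) * (r * N + C + 1)"
      by (intro mult_mono order_trans[OF _ E]) auto
    then show ?thesis
      using step_action_bound[OF sg[OF s] pos, of ?B "?x r"] by simp
  qed
  then have "eventually (\<lambda>r. norm (step_action d ?B ?k ?\<epsilon> (?x r)) \<le> K * exp (- r) * (r * N + C + 1)) at_top"
    by (intro eventually_mono[OF eventually_ge_at_top[of 0]])
  moreover have "((\<lambda>r. K * exp (- r) * (r * N + C + 1)) \<longlongrightarrow> 0) at_top"
    by real_asymp
  ultimately show "((\<lambda>r. step_action d ?B ?k ?\<epsilon> (?x r)) \<longlongrightarrow> 0) at_top"
    by (rule Lim_null_comparison)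
qed

theorem theorem6p3:
  fixes B :: "'n::{finite,linorder} int_mat"
    and d :: "'n int_vec"
    and k :: "nat \<Rightarrow> 'n"
    and \<epsilon> :: "nat \<Rightarrow> int"
    and T :: nat
    and \<sigma> :: "'n \<Rightarrow> 'n"
    and x :: "nat \<Rightarrow> 'n phase"
    and \<gamma> :: "nat \<Rightarrow> real \<Rightarrow> 'n phase"
  assumes "skew_symmetrizer d B"
    and "tropical_sign_sequence B k T \<epsilon>"
    and "\<sigma> permutes UNIV"
    and "sigma_periodic d B k \<epsilon> T \<sigma>"
    and "hamiltonian_flow d B k \<epsilon> T x \<gamma>"
  shows "action_integral d B k \<epsilon> T \<gamma> = 0"
proof -
  have sg: "\<epsilon> s = 1 \<or> \<epsilon> s = - 1" if "s < T" for s
    using assms(2) that by (auto simp: tropical_sign_sequence_def is_tropical_sign_def Let_def)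
  have "total_action d B k \<epsilon> T (r *\<^sub>R trop_start d) = total_action d B k \<epsilon> T (x 0)" for r
    using total_action_const[OF assms(1) sg assms(3,4)] by blast
  then have "((\<lambda>_. total_action d B k \<epsilon> T (x 0)) \<longlongrightarrow> 0) (at_top :: real filter)"
    using total_action_tendsto_0[OF assms(1,2) sg] by simp
  then have "total_action d B k \<epsilon> T (x 0) = 0"
    by (simp add: tendsto_const_iff)
  then show ?thesis
    using action_integral_eq_total_action[OF assms(1) sg assms(5)] by simp
qed

end
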